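(* Let $X$ and $Y$ be Banach spaces such that $\Phi_-(X,Y)\neq\emptyset$. (1) If $X\times X$ is isomorphic to $X$, then $\Phi\mathcal{C}(X,Y)=P\Phi_-(X,Y)$. (2) If every infinite codimensional closed subspace of $Y$ is contained in an infinite codimensional closed subspace $N$ of $Y$ which is isomorphic to a quotient of $X$, then $\Phi\mathcal{C}(X,Y)=\mathcal{SC}(X,Y)$.
   Context: $\mathcal{L}(X,Y)$ denotes the set of bounded linear operators from $X$ into $Y$. For Banach spaces, "isomorphic" means that there is a bijective bounded linear operator (with bounded inverse) between them; a quotient of $X$ is $X/M$ with $M$ a closed subspace of $X$. $X\times X$ is endowed with the norm $\|(x_1,x_2)\|_\infty=\max\{\|x_1\|,\|x_2\|\}$. $T\in\mathcal{L}(X,Y)$ is lower semi-Fredholm, $T\in\Phi_-(X,Y)$, if its range is finite codimensional in $Y$ (hence closed). $T$ is strictly cosingular, $T\in\mathcal{SC}(X,Y)$, if there is no infinite codimensional closed subspace $N$ of $Y$ such that $Q_NT$ is surjective, where $Q_N:Y\to Y/N$ is the quotient map. When $\Phi_-(X,Y)\neq\emptyset$: - the perturbation class is $P\Phi_-(X,Y)=\{K\in\mathcal{L}(X,Y): T+K\in\Phi_-(X,Y)\text{ for each }T\in\Phi_-(X,Y)\}$; - $\Phi\mathcal{C}(X,Y)$ (the $\Phi$-cosingular operators) is the set of $K\in\mathcal{L}(X,Y)$ such that for each $S\in\mathcal{L}(X,Y)$, $[S,K]\in\Phi_-(X\times X,Y)$ implies $S\in\Phi_-(X,Y)$, where $[S,K]:X\times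 X\to Y$ is $[S,K](x_1,x_2)=Sx_1+Kx_2$. *)

theory Defs
  imports "HOL-Analysis.Analysis"
begin

text \<open>
  Banach spaces over a scalar field \<open>'k\<close> that may be the reals or the complex numbers. The only
  finite-dimensional real normed fields are \<open>\<real>\<close> and \<open>\<complex>\<close>, so the sort
  \<open>{real_normed_field, euclidean_space}\<close> describes exactly these two cases. The library class
  \<^class>\<open>banach\<close> supplies the additive group, the complete norm and the real scalar multiplication;
  \<open>scale\<close> extends the latter to \<open>'k\<close>. The two lemmas after the locale are the instances that
  matter.
\<close>

locale banach_over = vector_space scale
  for scale :: "'k::{real_normed_field,euclidean_space} \<Rightarrow> 'a::banach \<Rightarrow> 'a" +
  assumes scale_of_real: "scale (of_real r) x = r *\<^sub>R x"
    and norm_scale: "norm (scale c x) = norm c * norm x"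

lemma banach_over_scaleR: "banach_over (scaleR :: real \<Rightarrow> 'a::banach \<Rightarrow> 'a)"
  by unfold_locales (simp_all add: scaleR_add_right scaleR_add_left)

lemma banach_over_complex: "banach_over ((*) :: complex \<Rightarrow> complex \<Rightarrow> complex)"
  by unfold_locales (simp_all add: algebra_simps norm_mult scaleR_conv_of_real)

text \<open>
  The product carries the library norm \<open>sqrt ((norm x)\<^sup>2 + (norm y)\<^sup>2)\<close>. It is equivalent to
  the maximum norm, hence gives the same bounded operators and the same isomorphisms.
\<close>

definition prod_scale :: "('k \<Rightarrow> 'a \<Rightarrow> 'a) \<Rightarrow> 'k \<Rightarrow> 'a \<times> 'a \<Rightarrow> 'a \<times> 'a" where
  "prod_scale s c p = (s c (fst p), s c (snd p))"

lemma banach_over_prod_scale: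
  assumes "banach_over s"
  shows "banach_over (prod_scale s)"
proof -
  interpret banach_over s by fact
  show ?thesis
  proof unfold_locales
    fix c and p :: "'b \<times> 'b"
    have "(norm (prod_scale s c p))\<^sup>2 = (norm c * norm p)\<^sup>2"
      by (simp add: prod_scale_def norm_prod_def norm_scale power_mult_distrib distrib_left)
    then show "norm (prod_scale s c p) = norm c * norm p"
      by (simp add: power2_eq_iff_nonneg)
  qed (auto simp: prod_scale_def scale_right_distrib scale_left_distrib scale_of_real prod_eq_iff)
qed

definition bounded_ops ::
    "('k \<Rightarrow> 'a \<Rightarrow> 'a) \<Rightarrow> ('k \<Rightarrow> 'b \<Rightarrow> 'b) \<Rightarrow> ('a::real_normed_vector \<Rightarrow>\<^sub>L 'b::real_normed_vector) set" where
  "bounded_ops s t = {T. \<forall>c x. blinfun_apply T (s c x) = t c (blinfun_apply T x)}"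

definition isomorphic ::
    "('k \<Rightarrow> 'a::real_normed_vector \<Rightarrow> 'a) \<Rightarrow> ('k \<Rightarrow> 'b::real_normed_vector \<Rightarrow> 'b) \<Rightarrow> bool" where
  "isomorphic s t \<longleftrightarrow>
     (\<exists>U\<in>bounded_ops s t. bij (blinfun_apply U) \<and> bounded_linear (inv (blinfun_apply U)))"

definition closed_subspace ::
    "('k::field \<Rightarrow> 'a \<Rightarrow> 'a) \<Rightarrow> 'a::real_normed_vector set \<Rightarrow> bool" where
  "closed_subspace s N \<longleftrightarrow> module.subspace s N \<and> closed N"

text \<open>
  The quotient by a subspace \<open>N\<close>: its elements are the cosets of \<open>N\<close>, and the quotient norm of a
  coset is the infimum of the norms of its elements.
\<close>

definition quot_map :: "'a::real_normed_vector set \<Rightarrow> 'a \<Rightarrow> 'a set" where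
  "quot_map N x = (+) x ` N"

definition quot_space :: "'a::real_normed_vector set \<Rightarrow> 'a set set" where
  "quot_space N = range (quot_map N)"

definition quot_norm :: "'a::real_normed_vector set \<Rightarrow> real" where
  "quot_norm C = Inf (norm ` C)"

text \<open>The quotient is spanned by the cosets of finitely many vectors.\<close>

definition finite_codim :: "('k::field \<Rightarrow> 'a \<Rightarrow> 'a) \<Rightarrow> 'a::real_normed_vector set \<Rightarrow> bool" where
  "finite_codim s N \<longleftrightarrow> (\<exists>B. finite B \<and> quot_map N ` module.span s B = quot_space N)"

text \<open>
  The closed subspace \<open>N\<close>, with the norm of its ambient space, is isomorphic to the quotient by the
  closed subspace \<open>M\<close>. Linearity of \<open>f\<close> is expressed on representatives.
\<close>

definition isomorphic_to_quotient ::
    "('k \<Rightarrow> 'b \<Rightarrow> 'b) \<Rightarrow> 'b::real_normed_vector set \<Rightarrow> ('k \<Rightarrow> 'a \<Rightarrow> 'a) \<Rightarrow> 'a::real_normed_vector set \<Rightarrow> bool" where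
  "isomorphic_to_quotient t N s M \<longleftrightarrow>
     (\<exists>f. bij_betw f (quot_space M) N \<and>
        (\<forall>x y. f (quot_map M (x + y)) = f (quot_map M x) + f (quot_map M y)) \<and>
        (\<forall>c x. f (quot_map M (s c x)) = t c (f (quot_map M x))) \<and>
        (\<exists>C. \<forall>q\<in>quot_space M. norm (f q) \<le> C * quot_norm q) \<and>
        (\<exists>C. \<forall>q\<in>quot_space M. quot_norm q \<le> C * norm (f q)))"

definition Phi_minus ::
    "('k::field \<Rightarrow> 'a \<Rightarrow> 'a) \<Rightarrow> ('k \<Rightarrow> 'b \<Rightarrow> 'b) \<Rightarrow>
     ('a::real_normed_vector \<Rightarrow>\<^sub>L 'b::real_normed_vector) set" where
  "Phi_minus s t = {T \<in> bounded_ops s t. finite_codim t (range (blinfun_apply T))}"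

definition strictly_cosingular ::
    "('k::field \<Rightarrow> 'a \<Rightarrow> 'a) \<Rightarrow> ('k \<Rightarrow> 'b \<Rightarrow> 'b) \<Rightarrow>
     ('a::real_normed_vector \<Rightarrow>\<^sub>L 'b::real_normed_vector) set" where
  "strictly_cosingular s t =
     {T \<in> bounded_ops s t.
        \<not> (\<exists>N. closed_subspace t N \<and> \<not> finite_codim t N \<and>
               range (quot_map N \<circ> blinfun_apply T) = quot_space N)}"

definition perturbation_class ::
    "('k::field \<Rightarrow> 'a \<Rightarrow> 'a) \<Rightarrow> ('k \<Rightarrow> 'b \<Rightarrow> 'b) \<Rightarrow>
     ('a::real_normed_vector \<Rightarrow>\<^sub>L 'b::real_normed_vector) set" where
  "perturbation_class s t =
     {K \<in> bounded_ops s t. \<forall>T\<in>Phi_minus s t. T + K \<in> Phi_minus s t}"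

definition pair_op ::
    "('a::real_normed_vector \<Rightarrow>\<^sub>L 'b::real_normed_vector) \<Rightarrow> ('a \<Rightarrow>\<^sub>L 'b) \<Rightarrow> ('a \<times> 'a) \<Rightarrow>\<^sub>L 'b" where
  "pair_op S K = (S o\<^sub>L fst_blinfun) + (K o\<^sub>L snd_blinfun)"

lemma pair_op_apply: "blinfun_apply (pair_op S K) (x1, x2) = blinfun_apply S x1 + blinfun_apply K x2"
  by (simp add: pair_op_def plus_blinfun.rep_eq)

definition Phi_cosingular ::
    "('k::field \<Rightarrow> 'a \<Rightarrow> 'a) \<Rightarrow> ('k \<Rightarrow> 'b \<Rightarrow> 'b) \<Rightarrow>
     ('a::real_normed_vector \<Rightarrow>\<^sub>L 'b::real_normed_vector) set" where
  "Phi_cosingular s t =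
     {K \<in> bounded_ops s t. \<forall>S\<in>bounded_ops s t.
        pair_op S K \<in> Phi_minus (prod_scale s) t \<longrightarrow> S \<in> Phi_minus s t}"

end

theory Submission
  imports Defs
begin

text \<open>
  Write \<open>R(T)\<close> for the range of \<open>T\<close>; the range of \<open>[S, K]\<close> is \<open>R(S) + R(K)\<close>. Three of the four
  inclusions are manipulations of ranges.

    \<^item> \<open>\<Phi>C \<subseteq> P\<Phi>\<^sub>-\<close>: applied to \<open>(x, -x)\<close>, the pair \<open>[T + K, K]\<close> gives \<open>T x\<close>. So it is lower
      semi-Fredholm whenever \<open>T\<close> is, and \<open>\<Phi>\<close>-cosingularity of \<open>K\<close> passes this on to \<open>T + K\<close>.
    \<^item> \<open>\<Phi>C \<subseteq> SC\<close> under the hypothesis on \<open>Y\<close>: if \<open>K\<close> is onto modulo an infinite codimensional closed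
      \<open>L\<close>, enlarge \<open>L\<close> to \<open>N\<close>, isomorphic to a quotient of \<open>X\<close>. Then \<open>N = R(S)\<close> for the composition
      \<open>S\<close> of the quotient map with the isomorphism. The pair \<open>[S, K]\<close> is onto, but \<open>S\<close> is not lower
      semi-Fredholm.
    \<^item> \<open>P\<Phi>\<^sub>- \<subseteq> \<Phi>C\<close> if \<open>X \<times> X\<close> is isomorphic to \<open>X\<close>: the class \<open>P\<Phi>\<^sub>-\<close> is stable under composition on the
      right with any operator \<open>A\<close> on \<open>X\<close>, because \<open>A = (A + r) - r\<close> is a difference of two invertible
      operators for large \<open>r\<close> (\<open>perturbation_class_compose\<close>). With \<open>V : X \<rightarrow> X \<times> X\<close> the isomorphism,
      \<open>[S, K] V = S (fst V) + K (snd V)\<close>, and removing the second summand leaves an operator whose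
      range lies in \<open>R(S)\<close>.

  The inclusion \<open>SC \<subseteq> \<Phi>C\<close> carries the analysis. Let \<open>[S, K]\<close> be lower semi-Fredholm and suppose that \<open>S\<close>
  is not. If \<open>R(S)\<close> were contained in an infinite codimensional closed \<open>N\<close>, then \<open>K\<close> would be onto modulo
  \<open>N\<close> up to finitely many dimensions, against strict cosingularity. In general \<open>R(S)\<close> may be dense, but
  an arbitrarily small perturbation \<open>S + C\<close> has its range in such an \<open>N\<close>
  (\<open>small_perturbation_infinite_codim\<close>). This suffices, since \<open>[S + C, K]\<close> is still lower
  semi-Fredholm if \<open>C\<close> is small (\<open>Phi_minus_open\<close>).

  To find \<open>C\<close>, choose inductively functionals \<open>\<phi>\<^sub>n\<close> and vectors \<open>y\<^sub>n\<close>, biorthogonal to each other, with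
  \<open>norm (\<phi>\<^sub>n (S x)) * norm y\<^sub>n \<le> e * (1/2)^(n+1) * norm x\<close>. Then \<open>C x = - (\<Sum>n. \<phi>\<^sub>n (S x) y\<^sub>n)\<close> is small and every
  \<open>\<phi>\<^sub>n\<close> vanishes on \<open>R(S + C)\<close>; the common kernel of the \<open>\<phi>\<^sub>n\<close> is the wanted \<open>N\<close>. Each \<open>\<phi>\<^sub>n\<close> comes from
  the Hahn-Banach theorem: as \<open>S\<close> is not lower semi-Fredholm, the successive approximation behind the open
  mapping theorem must fail at some vector modulo any given finite-dimensional space, and this failure
  says that a suitable seminorm is large at that vector (\<open>small_functional_on_range\<close>).
\<close>

section \<open>The Hahn-Banach theorem over a finite-dimensional field extension of the reals\<close>

text \<open>
  Homogeneity is stated as an inequality, which passes to infima; equality follows by scaling back.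
\<close>

definition sublinear :: "('a::real_vector \<Rightarrow> real) \<Rightarrow> bool" where
  "sublinear q \<longleftrightarrow> (\<forall>x y. q (x + y) \<le> q x + q y) \<and> (\<forall>r\<ge>0. \<forall>x. q (r *\<^sub>R x) \<le> r * q x)"

lemma sublinearD:
  assumes "sublinear q"
  shows "q (x + y) \<le> q x + q y" and "0 \<le> r \<Longrightarrow> q (r *\<^sub>R x) = r * q x"
proof -
  show "q (x + y) \<le> q x + q y"
    using assms by (simp add: sublinear_def)
  have le: "q (r *\<^sub>R x) \<le> r * q x" if "0 \<le> r" for r x
    using assms that by (simp add: sublinear_def)
  have "0 \<le> q 0"
    using assms by (force simp: sublinear_def dest: spec[of _ "0::'a"])
  moreover have "q x = q (inverse r *\<^sub>R (r *\<^sub>R x))" "q (inverse r *\<^sub>R (r *\<^sub>R x)) \<le> inverse r * q (r *\<^sub>R x)"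
    if "0 < r"
    using that le[of "inverse r" "r *\<^sub>R x"] by auto
  ultimately show "q (r *\<^sub>R x) = r * q x" if "0 \<le> r"
    using that le[of r x] by (cases "r = 0") (auto simp: field_simps)
qed

lemma sublinear_minus_le:
  assumes "sublinear q"
  shows "- q (- x) \<le> q x"
  using sublinearD(1)[OF assms, of x "- x"] sublinearD(2)[OF assms, of 0 0] by simp

text \<open>
  The lower bound \<open>- p (- x)\<close> of \<open>q x\<close>, valid for all sublinear \<open>q \<le> p\<close>, makes the infimum of a chain
  finite; comparability of two members is what makes the infimum subadditive. This is the step that
  Zorn's lemma needs to produce minimal sublinear functionals.
\<close>

lemma sublinear_Inf_chain:
  assumes "sublinear p" and "C \<noteq> {}"
    and C: "\<And>q. q \<in> C \<Longrightarrow> sublinear q \<and> q \<le> p"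
    and chain: "\<And>q q'. q \<in> C \<Longrightarrow> q' \<in> C \<Longrightarrow> q \<le> q' \<or> q' \<le> q"
  shows "sublinear (\<lambda>x. INF q\<in>C. q x)" and "\<And>q x. q \<in> C \<Longrightarrow> (INF q\<in>C. q x) \<le> q x"
proof -
  have bdd: "bdd_below ((\<lambda>q. q x) ` C)" for x
  proof (rule bdd_belowI2)
    fix q assume "q \<in> C"
    then show "- p (- x) \<le> q x"
      using sublinear_minus_le[of q x] C[of q] by (force simp: le_fun_def dest: spec[of _ "- x"])
  qed
  show lower: "\<And>q x. q \<in> C \<Longrightarrow> (INF q\<in>C. q x) \<le> q x"
    by (rule cINF_lower[OF bdd])
  show "sublinear (\<lambda>x. INF q\<in>C. q x)"
    unfolding sublinear_def
  proof (intro conjI allI impI)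
    fix x y
    have *: "(INF q\<in>C. q (x + y)) \<le> q1 x + q2 y" if q12: "q1 \<in> C" "q2 \<in> C" for q1 q2
    proof -
      obtain q where "q \<in> C" "q \<le> q1" "q \<le> q2"
        using chain[OF q12] q12 by (metis order_refl)
      then show ?thesis
        using lower[of q "x + y"] sublinearD(1)[of q x y] C[of q]
        by (smt (verit) le_fun_def)
    qed
    have "(INF q\<in>C. q (x + y)) - q2 y \<le> (INF q\<in>C. q x)" if "q2 \<in> C" for q2
      using *[OF _ that] by (intro cINF_greatest[OF \<open>C \<noteq> {}\<close>]) (simp add: algebra_simps)
    then have "(INF q\<in>C. q (x + y)) - (INF q\<in>C. q x) \<le> (INF q\<in>C. q y)"
      by (intro cINF_greatest[OF \<open>C \<noteq> {}\<close>]) (simp add: algebra_simps)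
    then show "(INF q\<in>C. q (x + y)) \<le> (INF q\<in>C. q x) + (INF q\<in>C. q y)"
      by simp
  next
    fix r :: real and x assume "0 \<le> r"
    have *: "(INF q\<in>C. q (r *\<^sub>R x)) \<le> r * q x" if "q \<in> C" for q
      using lower[OF that, of "r *\<^sub>R x"] sublinearD(2)[of q r x] C[OF that] \<open>0 \<le> r\<close> by simp
    show "(INF q\<in>C. q (r *\<^sub>R x)) \<le> r * (INF q\<in>C. q x)"
    proof (cases "r = 0")
      case True
      then show ?thesis using * \<open>C \<noteq> {}\<close> by fastforce
    next
      case False
      then have "(INF q\<in>C. q (r *\<^sub>R x)) / r \<le> (INF q\<in>C. q x)"
        using * \<open>0 \<le> r\<close> by (intro cINF_greatest[OF \<open>C \<noteq> {}\<close>]) (simp add: field_simps)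
      then show ?thesis
        using False \<open>0 \<le> r\<close> by (simp add: field_simps)
    qed
  qed
qed

text \<open>
  This is the largest sublinear \<open>h \<le> q\<close> with \<open>h (- a) \<le> - q a\<close>; that inequality is the case \<open>x = - a\<close>,
  \<open>t = 1\<close> of the second claim, and it forces every linear functional below \<open>h\<close> to be at least \<open>q a\<close>
  at \<open>a\<close>. If \<open>q\<close> is minimal then \<open>h = q\<close>, and the second claim with \<open>t = 1\<close> says that
  \<open>q x + q a \<le> q (x + a)\<close>.
\<close>

lemma sublinear_directional:
  fixes q :: "'a::real_vector \<Rightarrow> real" and a :: 'a
  assumes q: "sublinear q"
  defines "h \<equiv> \<lambda>x. INF t\<in>{0..}. q (x + t *\<^sub>R a) - t * q a"
  shows "sublinear h" and "\<And>x t. 0 \<le> t \<Longrightarrow> h x \<le> q (x + t *\<^sub>R a) - t * q a"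
proof -
  note add = sublinearD(1)[OF q] and scale = sublinearD(2)[OF q]
  have bdd: "bdd_below ((\<lambda>t. q (x + t *\<^sub>R a) - t * q a) ` {0..})" for x
  proof (rule bdd_belowI2)
    fix t :: real assume "t \<in> {0..}"
    then show "- q (- x) \<le> q (x + t *\<^sub>R a) - t * q a"
      using add[of "- x" "x + t *\<^sub>R a"] scale[of t a] by simp
  qed
  show lower: "\<And>x t. 0 \<le> t \<Longrightarrow> h x \<le> q (x + t *\<^sub>R a) - t * q a"
    unfolding h_def by (rule cINF_lower[OF bdd]) simp
  have greatest: "b \<le> h x" if "\<And>t. 0 \<le> t \<Longrightarrow> b \<le> q (x + t *\<^sub>R a) - t * q a" for b x
    unfolding h_def using that by (intro cINF_greatest) auto
  show "sublinear h"
    unfolding sublinear_def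
  proof (intro conjI allI impI)
    fix x y
    have *: "h (x + y) \<le> (q (x + s *\<^sub>R a) - s * q a) + (q (y + t *\<^sub>R a) - t * q a)"
      if "0 \<le> s" "0 \<le> t" for s t
      using lower[of "s + t" "x + y"] add[of "x + s *\<^sub>R a" "y + t *\<^sub>R a"] that
      by (simp add: algebra_simps)
    have "h (x + y) - (q (y + t *\<^sub>R a) - t * q a) \<le> h x" if "0 \<le> t" for t
    proof (rule greatest)
      show "h (x + y) - (q (y + t *\<^sub>R a) - t * q a) \<le> q (x + s *\<^sub>R a) - s * q a" if "0 \<le> s" for s
        using *[OF that \<open>0 \<le> t\<close>] by linarith
    qed
    then have "h (x + y) - h x \<le> h y"
      by (intro greatest) (smt (verit))
    then show "h (x + y) \<le> h x + h y"
      by simp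
  next
    fix r :: real and x assume r: "0 \<le> r"
    have *: "h (r *\<^sub>R x) \<le> r * (q (x + t *\<^sub>R a) - t * q a)" if "0 \<le> t" for t
      using lower[of "r * t" "r *\<^sub>R x"] scale[OF r, of "x + t *\<^sub>R a"] r that
      by (simp add: algebra_simps)
    show "h (r *\<^sub>R x) \<le> r * h x"
    proof (cases "r = 0")
      case True
      then show ?thesis using *[of 0] by simp
    next
      case False
      then have "h (r *\<^sub>R x) / r \<le> h x"
        using r * by (intro greatest) (simp add: field_simps)
      then show ?thesis
        using False r by (simp add: field_simps)
    qed
  qed
qed

text \<open>
  Minimal sublinear functionals are linear, so no extension from subspaces has to be constructed.
  Starting the descent at \<open>h p a\<close> instead of \<open>p\<close> secures the value at \<open>a\<close>.
\<close>

lemma Hahn_Banach_sublinear: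
  assumes p: "sublinear p"
  obtains u :: "'a::real_vector \<Rightarrow> real" where "linear u" "\<And>x. u x \<le> p x" "u a = p a"
proof -
  define h where "h q a = (\<lambda>x. INF t\<in>{0..}. q (x + t *\<^sub>R a) - t * q a)" for q and a :: 'a
  have h: "sublinear (h q a)" "\<And>x t. 0 \<le> t \<Longrightarrow> h q a x \<le> q (x + t *\<^sub>R a) - t * q a"
    if "sublinear q" for q a
    using sublinear_directional[OF that] by (auto simp: h_def)
  have h_le: "h q a \<le> q" if "sublinear q" for q a
    using h(2)[OF that, of 0 a] by (auto simp: le_fun_def)
  \<comment> \<open>A minimal element below \<open>h p a\<close> is minimal among all sublinear functionals.\<close>
  let ?A = "{q. sublinear q \<and> q \<le> h p a}"
  have "\<exists>m\<in>?A. \<forall>q\<in>?A. m \<ge> q \<longrightarrow> q = m"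
  proof (rule predicate_Zorn)
    show "partial_order_on ?A (relation_of (\<ge>) ?A)"
      by (rule partial_order_on_relation_ofI) auto
    fix C assume C: "C \<in> Chains (relation_of (\<ge>) ?A)"
    show "\<exists>u\<in>?A. \<forall>q\<in>C. u \<le> q"
    proof (cases "C = {}")
      case True
      then show ?thesis using h(1)[OF p] by blast
    next
      case False
      have CA: "q \<in> C \<Longrightarrow> sublinear q \<and> q \<le> h p a" for q
        using Chains_relation_of[OF C] by auto
      have chain: "q \<in> C \<Longrightarrow> q' \<in> C \<Longrightarrow> q \<le> q' \<or> q' \<le> q" for q q'
        using C by (auto simp: Chains_def relation_of_def)
      note Inf = sublinear_Inf_chain[OF h(1)[OF p] False CA chain]
      obtain q where "q \<in> C" using False by blast
      then have "(\<lambda>x. INF q\<in>C. q x) \<le> h p a"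
        using Inf(2) CA by (fastforce simp: le_fun_def intro: order_trans)
      then show ?thesis
        using Inf by (intro bexI[of _ "\<lambda>x. INF q\<in>C. q x"]) (auto simp: le_fun_def)
    qed
  qed
  then obtain m where m: "sublinear m" "m \<le> h p a"
    and min: "\<And>q. sublinear q \<Longrightarrow> q \<le> m \<Longrightarrow> q = m"
    by (auto dest: order_trans)
  have "h m b = m" for b
    by (rule min[OF h(1)[OF m(1)] h_le[OF m(1)]])
  then have "m x + m b \<le> m (x + b)" for x b
    using h(2)[OF m(1), of 1 b x] by simp
  with sublinearD(1)[OF m(1)] have add: "m (x + b) = m x + m b" for x b
    by (meson order_antisym)
  have "m 0 = 0"
    using sublinearD(2)[OF m(1), of 0 0] by simp
  have neg: "m (- x) = - m x" for x
    using add[of x "- x"] \<open>m 0 = 0\<close> by simp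
  have "m (r *\<^sub>R x) = r * m x" for r x
    using sublinearD(2)[OF m(1), of r x] sublinearD(2)[OF m(1), of "- r" x] neg[of "r *\<^sub>R x"]
    by (cases "0 \<le> r") auto
  then have "linear m"
    using add by (intro linearI) auto
  have "m (- a) \<le> p 0 - p a"
    using m(2) h(2)[OF p, of 1 a "- a"] by (auto simp: le_fun_def intro: order_trans)
  then have "p a \<le> m a"
    using neg[of a] sublinearD(2)[OF p, of 0 0] by simp
  moreover have le: "m x \<le> p x" for x
    using m(2) h_le[OF p, of a] by (auto simp: le_fun_def intro: order_trans)
  ultimately show thesis
    using that[OF \<open>linear m\<close> le] by (meson order_antisym)
qed

text \<open>
  The bilinear form \<open>(c * d) \<bullet> 1\<close> is nondegenerate since \<open>inverse d * d = 1\<close>, so by finite dimension it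
  represents every real-linear functional on the scalars. It plays the part of the real part of a
  product and turns real-linear functionals into scalar-valued ones without distinguishing
  the real from the complex case.
\<close>

lemma linear_functional_eq_inner_one:
  fixes g :: "'k::{real_normed_field,euclidean_space} \<Rightarrow> real"
  assumes "linear g"
  obtains d where "\<And>c. g c = (c * d) \<bullet> 1"
proof -
  define L :: "'k \<Rightarrow> 'k" where "L d = (\<Sum>b\<in>Basis. ((b * d) \<bullet> 1) *\<^sub>R b)" for d
  have lin: "linear (\<lambda>c. (c * d) \<bullet> 1)" for d :: 'k
    by (intro linearI) (simp_all add: distrib_right inner_add_left)
  have L: "c \<bullet> L d = (c * d) \<bullet> 1" for c d
  proof -
    have "(c * d) \<bullet> 1 = ((\<Sum>b\<in>Basis. (c \<bullet> b) *\<^sub>R b) * d) \<bullet> 1"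
      by (simp add: euclidean_representation)
    also have "\<dots> = (\<Sum>b\<in>Basis. (c \<bullet> b) * ((b * d) \<bullet> 1))"
      by (simp add: sum_distrib_right inner_sum_left)
    finally show ?thesis
      by (simp add: L_def inner_sum_right mult.commute)
  qed
  have linL: "linear L"
    unfolding L_def
    by (intro linearI)
      (simp_all add: distrib_left inner_add_left scaleR_add_left sum.distrib scaleR_sum_right)
  moreover have "inj L"
    unfolding linear_injective_0[OF linL]
  proof (intro allI impI)
    fix d :: 'k assume "L d = 0"
    then show "d = 0"
      using L[of "inverse d" d] by (cases "d = 0") auto
  qed
  ultimately have "surj L"
    by (rule linear_inj_imp_surj)
  then obtain d where d: "L d = (\<Sum>b\<in>Basis. g b *\<^sub>R b)"
    by (metis surjD)
  have "g c = (c * d) \<bullet> 1" for c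
  proof -
    have "g c = (\<Sum>b\<in>Basis. (c \<bullet> b) * g b)"
      using linear_sum[OF assms, of "\<lambda>b. (c \<bullet> b) *\<^sub>R b" Basis] linear_cmul[OF assms]
      by (simp add: euclidean_representation)
    then show ?thesis
      using L[of c d] by (simp add: d inner_sum_right mult.commute)
  qed
  then show thesis
    by (rule that)
qed

context banach_over
begin

lemma scaleR_eq_scale: "r *\<^sub>R x = scale (of_real r) x"
  by (simp add: scale_of_real)

text \<open>
  If \<open>u\<close> is a real-linear functional below the seminorm \<open>p\<close>, then \<open>u (c x) = (c * f x) \<bullet> 1\<close> defines a
  scalar-linear \<open>f\<close>. Rotating \<open>x\<close> by the unit scalar that makes \<open>c * f x\<close> equal to \<open>norm (f x)\<close> shows
  that \<open>f\<close> is bounded by \<open>p\<close> with the same constant as \<open>u\<close>.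
\<close>

theorem Hahn_Banach_seminorm:
  assumes add: "\<And>x y. p (x + y) \<le> p x + p y"
    and hom: "\<And>c x. p (scale c x) = norm c * p x"
    and le_norm: "\<And>x. p x \<le> M * norm x"
  obtains \<phi> where "\<phi> \<in> bounded_ops scale (*)"
    and "\<And>x. norm (blinfun_apply \<phi> x) \<le> p x" and "p a \<le> norm (blinfun_apply \<phi> a)"
proof -
  have "sublinear p"
    unfolding sublinear_def using add hom by (auto simp: scaleR_eq_scale)
  then obtain u where u: "linear u" "\<And>x. u x \<le> p x" "u a = p a"
    by (rule Hahn_Banach_sublinear[where a = a]) blast
  have "\<exists>d. \<forall>c. u (scale c x) = (c * d) \<bullet> 1" for x
  proof -
    have "linear (\<lambda>c. u (scale c x))"
    proof (rule linearI)
      show "u (scale (r *\<^sub>R c) x) = r *\<^sub>R u (scale c x)" for r c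
        using linear_cmul[OF u(1), of r "scale c x"] by (simp add: scaleR_eq_scale scaleR_conv_of_real)
    qed (simp add: scale_left_distrib linear_add[OF u(1)])
    then show ?thesis
      using linear_functional_eq_inner_one by blast
  qed
  then obtain f where f: "u (scale c x) = (c * f x) \<bullet> 1" for c x
    by metis
  have eqI: "d = e" if "\<And>c. (c * d) \<bullet> 1 = (c * e) \<bullet> 1" for d e :: 'k
  proof (rule ccontr)
    assume "d \<noteq> e"
    then show False
      using that[of "inverse (d - e)"] inner_diff_left[of "inverse (d - e) * d" "inverse (d - e) * e" 1]
      by (simp add: right_diff_distrib[symmetric])
  qed
  have f_add: "f (x + y) = f x + f y" for x y
    by (rule eqI)
      (simp add: f[symmetric] distrib_left inner_add_left scale_right_distrib linear_add[OF u(1)])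
  have f_scale: "f (scale c x) = c * f x" for c x
    by (rule eqI) (simp add: f[symmetric] mult.assoc[symmetric])
  have f_le: "norm (f x) \<le> p x" for x
  proof (cases "f x = 0")
    case True
    then show ?thesis
      using add[of x "scale (- 1) x"] hom[of "- 1" x] hom[of 0 x] by simp
  next
    case False
    define c where "c = of_real (norm (f x)) / f x"
    have "c * f x = of_real (norm (f x))" "norm c = 1"
      using False by (auto simp: c_def norm_divide)
    moreover have "(of_real (norm (f x)) :: 'k) \<bullet> 1 = norm (f x)"
      by (simp add: of_real_def power2_norm_eq_inner[symmetric])
    ultimately show ?thesis
      using f[of c x] u(2)[of "scale c x"] hom[of c x] by simp
  qed
  have bl: "bounded_linear f"
  proof (rule bounded_linear_intro)
    show "norm (f x) \<le> norm x * M" for x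
      using f_le[of x] le_norm[of x] by (simp add: mult.commute)
  qed (auto simp: f_add scaleR_eq_scale f_scale scaleR_conv_of_real)
  have "p a \<le> norm (f a)"
    using u(3) f[of 1 a] norm_cauchy_schwarz[of "f a" 1] by simp
  with f_le show thesis
    by (intro that[of "Blinfun f"])
      (auto simp: bounded_ops_def bounded_linear_Blinfun_apply[OF bl] f_scale)
qed

end

section \<open>Surjectivity modulo a closed subspace\<close>

text \<open>
  One step of the successive approximation in the proof of the open mapping theorem, modulo \<open>F\<close>: a
  vector is matched up to the factor \<open>q\<close> with controlled cost in \<open>x\<close>. There is no control on the
  summand in \<open>F\<close>; closedness of \<open>F\<close> replaces it.
\<close>

definition nearly_onto ::
    "('a::real_normed_vector \<Rightarrow>\<^sub>L 'b::real_normed_vector) \<Rightarrow> 'b set \<Rightarrow> real \<Rightarrow> real \<Rightarrow> bool" where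
  "nearly_onto S F K q \<longleftrightarrow>
     (\<forall>y. \<exists>x. \<exists>f\<in>F. norm x \<le> K * norm y \<and> norm (y - blinfun_apply S x - f) \<le> q * norm y)"

text \<open>
  Iterating the approximation step, the corrections in \<open>x\<close> form an absolutely convergent series. The
  partial sums of the corrections in \<open>F\<close> converge as well, being the difference of convergent sequences,
  and their limit stays in \<open>F\<close>.
\<close>

lemma nearly_onto_imp_onto:
  fixes S :: "'a::banach \<Rightarrow>\<^sub>L 'b::banach"
  assumes F: "subspace F" "closed F" and near: "nearly_onto S F K q" and "0 \<le> K" "0 \<le> q" "q < 1"
  shows "\<exists>x. \<exists>f\<in>F. y = blinfun_apply S x + f"
proof -
  obtain g h where gh: "h y \<in> F" "norm (g y) \<le> K * norm y"
      "norm (y - blinfun_apply S (g y) - h y) \<le> q * norm y" for y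
    using near unfolding nearly_onto_def by metis
  define r where "r n = ((\<lambda>y. y - blinfun_apply S (g y) - h y) ^^ n) y" for n
  have r_Suc: "r (Suc n) = r n - blinfun_apply S (g (r n)) - h (r n)" for n
    by (simp add: r_def)
  have r_le: "norm (r n) \<le> q ^ n * norm y" for n
  proof (induction n)
    case (Suc n)
    have "norm (r (Suc n)) \<le> q * norm (r n)"
      unfolding r_Suc by (rule gh(3))
    also have "\<dots> \<le> q * (q ^ n * norm y)"
      using Suc \<open>0 \<le> q\<close> by (rule mult_left_mono)
    finally show ?case by simp
  qed (simp add: r_def)
  have q_sum: "summable (\<lambda>n. K * norm y * q ^ n)"
    using \<open>0 \<le> q\<close> \<open>q < 1\<close> by (intro summable_mult summable_geometric) simp
  have "norm (g (r n)) \<le> K * norm y * q ^ n" for n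
    using order_trans[OF gh(2) mult_left_mono[OF r_le[of n] \<open>0 \<le> K\<close>]] by (simp add: mult_ac)
  then have "summable (\<lambda>n. g (r n))"
    by (intro summable_comparison_test'[OF q_sum])
  then have "(\<lambda>n. \<Sum>i<n. g (r i)) \<longlonglongrightarrow> (\<Sum>i. g (r i))"
    by (rule summable_LIMSEQ)
  then have Sx: "(\<lambda>n. blinfun_apply S (\<Sum>i<n. g (r i))) \<longlonglongrightarrow> blinfun_apply S (\<Sum>i. g (r i))"
    by (intro tendsto_intros)
  have "(\<lambda>n. q ^ n * norm y) \<longlonglongrightarrow> 0 * norm y"
    using \<open>0 \<le> q\<close> \<open>q < 1\<close> by (intro tendsto_intros LIMSEQ_realpow_zero)
  then have "(\<lambda>n. q ^ n * norm y) \<longlonglongrightarrow> 0"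
    by simp
  then have r0: "r \<longlonglongrightarrow> 0"
    by (rule Lim_null_comparison[OF always_eventually[OF allI[OF r_le]]])
  have "(\<Sum>i<n. h (r i)) = y - r n - blinfun_apply S (\<Sum>i<n. g (r i))" for n
    by (induction n) (simp_all add: r_def[of 0] r_Suc blinfun.add_right)
  moreover have "(\<lambda>n. y - r n - blinfun_apply S (\<Sum>i<n. g (r i)))
      \<longlonglongrightarrow> y - 0 - blinfun_apply S (\<Sum>i. g (r i))"
    by (intro tendsto_intros r0 Sx)
  ultimately have lim: "(\<lambda>n. \<Sum>i<n. h (r i)) \<longlonglongrightarrow> y - blinfun_apply S (\<Sum>i. g (r i))"
    by simp
  have "(\<Sum>i<n. h (r i)) \<in> F" for n
    by (intro subspace_sum F(1) gh(1))
  then have "y - blinfun_apply S (\<Sum>i. g (r i)) \<in> F"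
    by (rule closed_sequentially[OF F(2) _ lim])
  then show ?thesis
    by (intro exI[of _ "\<Sum>i. g (r i)"] bexI[of _ "y - blinfun_apply S (\<Sum>i. g (r i))"]) auto
qed

text \<open>
  By Baire's theorem, for some \<open>n\<close> the set \<open>S (cball 0 n) + F\<close> is dense in a ball. Differences of its
  elements then approximate all vectors in a ball around \<open>0\<close>, and the rest is scaling.
\<close>

lemma onto_imp_nearly_onto:
  fixes S :: "'a::real_normed_vector \<Rightarrow>\<^sub>L 'b::banach"
  assumes F: "subspace F" and onto: "\<And>y. \<exists>x. \<exists>f\<in>F. y = blinfun_apply S x + f" and "0 < q"
  obtains K where "0 \<le> K" "nearly_onto S F K q"
proof -
  define D where "D n = {blinfun_apply S x + f |x f. norm x \<le> real n \<and> f \<in> F}" for n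
  have "y \<in> (\<Union>n. closure (D n))" for y
  proof -
    obtain x f where "f \<in> F" "y = blinfun_apply S x + f"
      using onto by blast
    moreover obtain n where "norm x \<le> real n"
      using real_arch_simple by blast
    ultimately have "y \<in> D n"
      unfolding D_def by blast
    then show ?thesis
      using closure_subset by blast
  qed
  then have "\<Union> (range (\<lambda>n. closure (D n))) = UNIV"
    by blast
  then have "\<exists>n. interior (closure (D n)) \<noteq> {}"
    using Baire_category_alt[of euclidean "range (\<lambda>n. closure (D n))"]
      completely_metrizable_space_euclidean by fastforce
  then obtain n z where "z \<in> interior (closure (D n))"
    by blast
  then obtain r where r: "0 < r" "ball z r \<subseteq> closure (D n)"
    by (meson mem_interior)
  have approx: "\<exists>x f. norm x \<le> real n \<and> f \<in> F \<and> norm (w - blinfun_apply S x - f) < q * r / 4"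
    if w: "w \<in> ball z r" for w
  proof -
    have "w \<in> closure (D n)" "0 < q * r / 4"
      using w r \<open>0 < q\<close> by auto
    then obtain v where "v \<in> D n" "dist v w < q * r / 4"
      by (meson closure_approachable)
    then obtain x f where "norm x \<le> real n" "f \<in> F" "norm (w - (blinfun_apply S x + f)) < q * r / 4"
      unfolding D_def by (auto simp: dist_norm norm_minus_commute)
    then show ?thesis
      by (intro exI[of _ x] exI[of _ f]) (simp add: diff_diff_eq)
  qed
  have "nearly_onto S F (4 * real n / r) q"
    unfolding nearly_onto_def
  proof
    fix y
    show "\<exists>x. \<exists>f\<in>F. norm x \<le> 4 * real n / r * norm y \<and> norm (y - blinfun_apply S x - f) \<le> q * norm y"
    proof (cases "y = 0")
      case True
      then show ?thesis
        using subspace_0[OF F] by (intro exI[of _ 0] bexI[of _ 0]) auto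
    next
      case False
      \<comment> \<open>This scaling puts \<open>z + c y\<close> into the ball around \<open>z\<close>; the difference of approximations to it and to \<open>z\<close> approximates \<open>c y\<close>.\<close>
      define c where "c = r / (2 * norm y)"
      have c: "0 < c" "norm (c *\<^sub>R y) = r / 2"
        using False r by (auto simp: c_def)
      have cy: "c * norm y = r / 2"
        using False by (simp add: c_def)
      have "z \<in> ball z r" "z + c *\<^sub>R y \<in> ball z r"
        using r c by (auto simp: dist_norm)
      then obtain x1 f1 x2 f2 where
        1: "norm x1 \<le> real n" "f1 \<in> F" "norm (z - blinfun_apply S x1 - f1) < q * r / 4" and
        2: "norm x2 \<le> real n" "f2 \<in> F" "norm (z + c *\<^sub>R y - blinfun_apply S x2 - f2) < q * r / 4"
        using approx by metis
      define x f where "x = inverse c *\<^sub>R (x2 - x1)" and "f = inverse c *\<^sub>R (f2 - f1)"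
      have cx: "c *\<^sub>R x = x2 - x1" and cf: "c *\<^sub>R f = f2 - f1"
        using c(1) by (simp_all add: x_def f_def)
      have "f \<in> F"
        unfolding f_def using F 1(2) 2(2) by (intro subspace_scale subspace_diff)
      moreover have "norm x \<le> 4 * real n / r * norm y"
      proof -
        have "c * norm x = norm (x2 - x1)"
          using c(1) by (simp add: cx[symmetric])
        also have "\<dots> \<le> 2 * real n"
          using norm_triangle_ineq4[of x2 x1] 1 2 by linarith
        also have "2 * real n = 4 * real n / r * (c * norm y)"
          unfolding cy using r by simp
        also have "\<dots> = c * (4 * real n / r * norm y)"
          by (simp only: mult_ac)
        finally show ?thesis
          using c(1) by (simp only: mult_le_cancel_left_pos)
      qed
      moreover have "norm (y - blinfun_apply S x - f) \<le> q * norm y"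
      proof -
        let ?w1 = "z - blinfun_apply S x1 - f1" and ?w2 = "z + c *\<^sub>R y - blinfun_apply S x2 - f2"
        have "c *\<^sub>R (y - blinfun_apply S x - f) = c *\<^sub>R y - blinfun_apply S (x2 - x1) - (f2 - f1)"
          by (simp add: scaleR_diff_right cf blinfun.scaleR_right[symmetric] cx)
        also have "\<dots> = ?w2 - ?w1"
          by (simp add: blinfun.diff_right)
        finally have "norm (c *\<^sub>R (y - blinfun_apply S x - f)) = norm (?w2 - ?w1)"
          by (rule arg_cong)
        then have "c * norm (y - blinfun_apply S x - f) = norm (?w2 - ?w1)"
          using c(1) by (simp only: norm_scaleR abs_of_pos)
        also have "\<dots> \<le> q * r / 2"
          using norm_triangle_ineq4[of ?w2 ?w1] 1 2 by linarith
        also have "q * r / 2 = q * (c * norm y)"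
          unfolding cy by simp
        also have "\<dots> = c * (q * norm y)"
          by (simp only: mult_ac)
        finally show ?thesis
          using c(1) by (simp only: mult_le_cancel_left_pos)
      qed
      ultimately show ?thesis by blast
    qed
  qed
  then show thesis
    using that[of "4 * real n / r"] r by simp
qed

text \<open>
  The approximation property with \<open>q = 1/4\<close> survives a perturbation of size \<open>1 / (4 * (K + 1))\<close>, at the
  price of \<open>q = 1/2\<close>, which still suffices for the iteration.
\<close>

lemma onto_stable:
  fixes S :: "'a::banach \<Rightarrow>\<^sub>L 'b::banach"
  assumes F: "subspace F" "closed F" and onto: "\<And>y. \<exists>x. \<exists>f\<in>F. y = blinfun_apply S x + f"
  obtains e where "0 < e" "\<And>P y. norm P \<le> e \<Longrightarrow> \<exists>x. \<exists>f\<in>F. y = blinfun_apply (S + P) x + f"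
proof -
  obtain K where K: "0 \<le> K" "nearly_onto S F K (1/4)"
    by (rule onto_imp_nearly_onto[OF F(1) onto]) auto
  show thesis
  proof (rule that[of "1 / (4 * (K + 1))"])
    show "0 < 1 / (4 * (K + 1))"
      using K by simp
    fix P :: "'a \<Rightarrow>\<^sub>L 'b" assume P: "norm P \<le> 1 / (4 * (K + 1))"
    have "nearly_onto (S + P) F K (1/2)"
      unfolding nearly_onto_def
    proof
      fix y
      obtain x f where x: "f \<in> F" "norm x \<le> K * norm y"
          "norm (y - blinfun_apply S x - f) \<le> 1/4 * norm y"
        using K(2) unfolding nearly_onto_def by blast
      have "norm (blinfun_apply P x) \<le> norm P * norm x"
        by (rule norm_blinfun)
      also have "\<dots> \<le> 1 / (4 * (K + 1)) * (K * norm y)"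
        using P x K by (intro mult_mono) auto
      also have "\<dots> = (K / (K + 1)) * (1/4 * norm y)"
        using K by (simp add: field_simps)
      also have "\<dots> \<le> 1 * (1/4 * norm y)"
        using K by (intro mult_right_mono) auto
      finally have "norm (blinfun_apply P x) \<le> 1/4 * norm y"
        by simp
      moreover have "norm (y - blinfun_apply (S + P) x - f)
          = norm ((y - blinfun_apply S x - f) - blinfun_apply P x)"
        by (simp add: blinfun.add_left algebra_simps)
      ultimately have "norm (y - blinfun_apply (S + P) x - f) \<le> 1/2 * norm y"
        using x norm_triangle_ineq4[of "y - blinfun_apply S x - f" "blinfun_apply P x"] by linarith
      with x show "\<exists>x. \<exists>f\<in>F. norm x \<le> K * norm y \<and> norm (y - blinfun_apply (S + P) x - f) \<le> 1/2 * norm y"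
        by blast
    qed
    then show "\<exists>x. \<exists>f\<in>F. y = blinfun_apply (S + P) x + f" for y
      using nearly_onto_imp_onto[OF F _ K(1), of "S + P" "1/2"] by simp
  qed
qed

context banach_over
begin

lemma real_subspace: "subspace V \<Longrightarrow> Real_Vector_Spaces.subspace V"
  by (auto simp: Real_Vector_Spaces.subspace_def subspace_0 subspace_add subspace_scale scaleR_eq_scale)

lemma tendsto_scale:
  assumes "c \<longlonglongrightarrow> l"
  shows "(\<lambda>n. scale (c n) x) \<longlonglongrightarrow> scale l x"
proof (rule LIM_zero_cancel, rule tendsto_norm_zero_cancel)
  have "(\<lambda>n. norm (c n - l) * norm x) \<longlonglongrightarrow> norm (l - l) * norm x"
    by (intro tendsto_intros assms)
  then show "(\<lambda>n. norm (scale (c n) x - scale l x)) \<longlonglongrightarrow> 0"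
    by (simp add: scale_left_diff_distrib[symmetric] norm_scale)
qed

text \<open>
  For \<open>b\<close> outside the closed \<open>span A\<close>, the distance from \<open>b\<close> to \<open>span A\<close> bounds the coefficient of \<open>b\<close>
  in a vector of the larger span. So the coefficients of a convergent sequence are Cauchy and converge
  in the complete scalar field.
\<close>

lemma closed_span_insert:
  assumes "closed (span A)"
  shows "closed (span (insert b A))"
proof (cases "b \<in> span A")
  case True
  then show ?thesis
    using assms by (simp add: span_redundant)
next
  case False
  then have "open (- span A)" "b \<in> - span A"
    using assms by auto
  then obtain d where d: "0 < d" "ball b d \<subseteq> - span A"
    by (rule openE)
  have dist_le: "d \<le> norm (v - b)" if "v \<in> span A" for v
  proof (rule ccontr)
    assume "\<not> d \<le> norm (v - b)"
    then have "v \<in> ball b d"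
      by (simp add: dist_norm norm_minus_commute)
    then show False
      using d(2) that by blast
  qed
  have lower: "norm c * d \<le> norm (v + scale c b)" if "v \<in> span A" for v c
  proof (cases "c = 0")
    case False
    have "scale (- inverse c) v \<in> span A"
      using that by (rule span_scale)
    from dist_le[OF this] have "norm c * d \<le> norm c * norm (scale (- inverse c) v - b)"
      by (intro mult_left_mono) auto
    also have "\<dots> = norm (scale (- c) (scale (- inverse c) v - b))"
      by (simp only: norm_scale norm_minus_cancel)
    also have "scale (- c) (scale (- inverse c) v - b) = v + scale c b"
      using False by (simp add: scale_right_diff_distrib)
    finally show ?thesis .
  qed simp
  show ?thesis
    unfolding closed_sequential_limits
  proof (intro allI impI, elim conjE)
    fix w l assume w: "\<forall>n. w n \<in> span (insert b A)" and l: "w \<longlonglongrightarrow> l"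
    then have "\<forall>n. \<exists>c. w n - scale c b \<in> span A"
      by (simp add: span_breakdown_eq)
    then obtain c where c: "w n - scale (c n) b \<in> span A" for n
      by metis
    have c_le: "norm (c m - c n) * d \<le> norm (w m - w n)" for m n
      using lower[OF span_diff[OF c[of m] c[of n]], of "c m - c n"]
      by (simp add: scale_left_diff_distrib algebra_simps)
    have "Cauchy c"
    proof (rule CauchyI)
      fix e :: real assume "0 < e"
      moreover have "Cauchy w"
        using l by (rule LIMSEQ_imp_Cauchy)
      ultimately obtain M where "\<forall>m\<ge>M. \<forall>n\<ge>M. norm (w m - w n) < e * d"
        using d(1) by (meson CauchyD mult_pos_pos)
      then have "\<forall>m\<ge>M. \<forall>n\<ge>M. norm (c m - c n) * d < e * d"
        using c_le by (meson order_le_less_trans)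
      then show "\<exists>M. \<forall>m\<ge>M. \<forall>n\<ge>M. norm (c m - c n) < e"
        using d(1) by auto
    qed
    then obtain k where "c \<longlonglongrightarrow> k"
      using Cauchy_convergent convergentD by blast
    then have "(\<lambda>n. w n - scale (c n) b) \<longlonglongrightarrow> l - scale k b"
      by (intro tendsto_diff l tendsto_scale)
    then have "l - scale k b \<in> span A"
      by (rule closed_sequentially[OF assms c])
    then show "l \<in> span (insert b A)"
      by (auto simp: span_breakdown_eq)
  qed
qed

lemma closed_span_Un_finite:
  assumes "closed (span A)" "finite B"
  shows "closed (span (A \<union> B))"
  using assms(2) by induction (auto simp: assms(1) closed_span_insert)

lemma closed_span_finite: "finite B \<Longrightarrow> closed (span B)"
  using closed_span_Un_finite[of "{}" B] by simp

end

section \<open>Finite codimension\<close>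

context banach_over
begin

lemma quot_map_eq_iff:
  assumes N: "subspace N"
  shows "quot_map N x = quot_map N y \<longleftrightarrow> x - y \<in> N"
proof
  assume "quot_map N x = quot_map N y"
  moreover have "x \<in> quot_map N x"
    using subspace_0[OF N] by (auto simp: quot_map_def image_iff)
  ultimately show "x - y \<in> N"
    by (auto simp: quot_map_def)
next
  have le: "quot_map N u \<subseteq> quot_map N v" if "u - v \<in> N" for u v
  proof
    fix w assume "w \<in> quot_map N u"
    then obtain n where "n \<in> N" "w = u + n"
      by (auto simp: quot_map_def)
    then have "(u - v) + n \<in> N" "w = v + ((u - v) + n)"
      using subspace_add[OF N that] by auto
    then show "w \<in> quot_map N v"
      unfolding quot_map_def by blast
  qed
  assume "x - y \<in> N"
  then have "x - y \<in> N" "y - x \<in> N"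
    using subspace_neg[OF N, of "x - y"] by auto
  then show "quot_map N x = quot_map N y"
    by (intro antisym le)
qed

lemma finite_codim_iff:
  assumes N: "subspace N"
  shows "finite_codim scale N \<longleftrightarrow> (\<exists>B. finite B \<and> (\<forall>y. \<exists>b\<in>span B. y - b \<in> N))"
proof -
  have "quot_map N ` span B = quot_space N \<longleftrightarrow> (\<forall>y. \<exists>b\<in>span B. y - b \<in> N)" for B
  proof -
    have "quot_map N ` span B = quot_space N \<longleftrightarrow> (\<forall>y. quot_map N y \<in> quot_map N ` span B)"
      unfolding quot_space_def by blast
    then show ?thesis
      by (simp add: image_iff quot_map_eq_iff[OF N])
  qed
  then show ?thesis
    by (simp add: finite_codim_def)
qed

lemma span_Un_subspace_left:
  assumes "subspace N"
  shows "y \<in> span (N \<union> B) \<longleftrightarrow> (\<exists>b\<in>span B. y - b \<in> N)"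
proof -
  have "span N = N"
    using assms by (simp add: span_eq_iff)
  show ?thesis
    unfolding span_Un \<open>span N = N\<close>
    by (force simp: diff_eq_eq)
qed

lemma finite_codim_span_Un_finite:
  assumes N: "subspace N" and "finite B" and fc: "finite_codim scale (span (N \<union> B))"
  shows "finite_codim scale N"
proof -
  obtain B' where B': "finite B'" "\<And>y. \<exists>b\<in>span B'. y - b \<in> span (N \<union> B)"
    using fc finite_codim_iff[OF subspace_span] by auto
  have "\<exists>b\<in>span (B' \<union> B). y - b \<in> N" for y
  proof -
    obtain b' where b': "b' \<in> span B'" "y - b' \<in> span (N \<union> B)"
      using B'(2) by blast
    then obtain b where b: "b \<in> span B" "y - b' - b \<in> N"
      using span_Un_subspace_left[OF N] by blast
    then have "b' + b \<in> span (B' \<union> B)"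
      unfolding span_Un using b' by blast
    with b(2) show ?thesis
      by (intro bexI[of _ "b' + b"]) (simp_all add: diff_diff_eq)
  qed
  then show ?thesis
    using finite_codim_iff[OF N] B'(1) \<open>finite B\<close> by (meson finite_UnI)
qed

lemma bounded_ops_functionalD:
  assumes "\<phi> \<in> bounded_ops scale (*)"
  shows "blinfun_apply \<phi> (scale c x) = c * blinfun_apply \<phi> x"
  using assms by (simp add: bounded_ops_def)

lemma subspace_kernel:
  assumes "\<And>i. i \<in> I \<Longrightarrow> \<phi> i \<in> bounded_ops scale (*)"
  shows "subspace {y. \<forall>i\<in>I. blinfun_apply (\<phi> i) y = 0}"
  using assms bounded_ops_functionalD
  by (intro subspaceI) (auto simp: blinfun.add_right)

lemma closed_kernel: "closed {y. \<forall>i\<in>I. blinfun_apply (\<phi> i) y = 0}"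
proof -
  have "{y. \<forall>i\<in>I. blinfun_apply (\<phi> i) y = 0} = (\<Inter>i\<in>I. {y. blinfun_apply (\<phi> i) y = 0})"
    by auto
  also have "closed \<dots>"
    by (intro closed_INT ballI closed_Collect_eq continuous_intros)
  finally show ?thesis .
qed

text \<open>
  If finitely many vectors spanned the quotient by \<open>N\<close>, the \<open>y n\<close> could be replaced, modulo \<open>N\<close>, by
  vectors in their span without changing the values of the functionals. Biorthogonality makes these
  infinitely many vectors linearly independent.
\<close>

lemma biorthogonal_imp_not_finite_codim:
  fixes \<phi> :: "nat \<Rightarrow> 'a \<Rightarrow>\<^sub>L 'k" and y :: "nat \<Rightarrow> 'a"
  assumes \<phi>: "\<And>n. \<phi> n \<in> bounded_ops scale (*)"
    and biorth: "\<And>m n. blinfun_apply (\<phi> m) (y n) = (if m = n then 1 else 0)"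
    and N: "subspace N" "\<And>n v. v \<in> N \<Longrightarrow> blinfun_apply (\<phi> n) v = 0"
  shows "\<not> finite_codim scale N"
proof
  assume "finite_codim scale N"
  then obtain B where B: "finite B" "\<And>y. \<exists>b\<in>span B. y - b \<in> N"
    using finite_codim_iff[OF N(1)] by auto
  then have "\<forall>n. \<exists>b. b \<in> span B \<and> y n - b \<in> N"
    by blast
  then obtain b where b: "b n \<in> span B" "y n - b n \<in> N" for n
    by metis
  have \<phi>b: "blinfun_apply (\<phi> m) (b n) = (if m = n then 1 else 0)" for m n
    using N(2)[OF b(2), of m n] biorth[of m n] by (simp add: blinfun.diff_right)
  then have inj: "inj b"
    by (metis injI zero_neq_one)
  have "independent (range b)"
    unfolding dependent_def
  proof safe
    fix n assume n: "b n \<in> span (range b - {b n})"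
    have "range b - {b n} \<subseteq> {v. \<forall>i\<in>{n}. blinfun_apply (\<phi> i) v = 0}"
      using \<phi>b by auto
    then have "span (range b - {b n}) \<subseteq> {v. \<forall>i\<in>{n}. blinfun_apply (\<phi> i) v = 0}"
      by (intro span_minimal subspace_kernel \<phi>)
    then show False
      using n \<phi>b[of n n] by auto
  qed
  then have "finite (range b)"
    using independent_span_bound[OF B(1)] b(1) by blast
  then show False
    using inj finite_imageD infinite_UNIV_nat by blast
qed

end

section \<open>Lower semi-Fredholm operators\<close>

locale operators_between = dom: banach_over sX + cod: banach_over sY
  for sX :: "'k::{real_normed_field,euclidean_space} \<Rightarrow> 'x::banach \<Rightarrow> 'x"
    and sY :: "'k \<Rightarrow> 'y::banach \<Rightarrow> 'y"
begin

lemma bounded_opsD: "T \<in> bounded_ops sX sY \<Longrightarrow> blinfun_apply T (sX c x) = sY c (blinfun_apply T x)"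
  by (simp add: bounded_ops_def)

lemma bounded_ops_add: "S \<in> bounded_ops sX sY \<Longrightarrow> T \<in> bounded_ops sX sY \<Longrightarrow> S + T \<in> bounded_ops sX sY"
  by (simp add: bounded_ops_def blinfun.add_left cod.scale_right_distrib)

lemma bounded_ops_uminus: "T \<in> bounded_ops sX sY \<Longrightarrow> - T \<in> bounded_ops sX sY"
  by (simp add: bounded_ops_def blinfun.minus_left)

lemma subspace_range: "T \<in> bounded_ops sX sY \<Longrightarrow> cod.subspace (range (blinfun_apply T))"
  by (intro cod.subspaceI)
    (auto simp: blinfun.add_right[symmetric] bounded_opsD[symmetric] intro: range_eqI[of _ _ 0])

text \<open>
  Lower semi-Fredholm means surjective modulo a finite-dimensional subspace, which is closed. This
  makes the results on \<open>nearly_onto\<close> applicable.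
\<close>

lemma Phi_minus_iff:
  "T \<in> Phi_minus sX sY \<longleftrightarrow> T \<in> bounded_ops sX sY \<and>
     (\<exists>B. finite B \<and> (\<forall>y. \<exists>x. \<exists>f\<in>cod.span B. y = blinfun_apply T x + f))"
proof (cases "T \<in> bounded_ops sX sY")
  case True
  have "(\<exists>b\<in>cod.span B. y - b \<in> range (blinfun_apply T)) \<longleftrightarrow>
      (\<exists>x. \<exists>f\<in>cod.span B. y = blinfun_apply T x + f)" for y B
    by (auto simp: image_iff diff_eq_eq)
  then show ?thesis
    using True by (simp add: Phi_minus_def cod.finite_codim_iff[OF subspace_range])
qed (simp add: Phi_minus_def)

lemma Phi_minus_mono_range:
  assumes "S \<in> Phi_minus sX sY" "T \<in> bounded_ops sX sY"
    and "range (blinfun_apply S) \<subseteq> range (blinfun_apply T)"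
  shows "T \<in> Phi_minus sX sY"
  using assms unfolding Phi_minus_iff by (metis (no_types, lifting) image_subset_iff rangeE UNIV_I)

lemma Phi_minus_open:
  assumes "T \<in> Phi_minus sX sY"
  obtains e where "0 < e" "\<And>P. P \<in> bounded_ops sX sY \<Longrightarrow> norm P \<le> e \<Longrightarrow> T + P \<in> Phi_minus sX sY"
proof -
  obtain B where T: "T \<in> bounded_ops sX sY" and B: "finite B"
      "\<And>y. \<exists>x. \<exists>f\<in>cod.span B. y = blinfun_apply T x + f"
    using assms by (auto simp: Phi_minus_iff)
  obtain e where e: "0 < e"
      "\<And>P y. norm P \<le> e \<Longrightarrow> \<exists>x. \<exists>f\<in>cod.span B. y = blinfun_apply (T + P) x + f"
    using onto_stable[OF cod.real_subspace[OF cod.subspace_span] cod.closed_span_finite[OF B(1)] B(2)]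
    by blast
  show thesis
  proof (rule that[OF e(1)])
    show "T + P \<in> Phi_minus sX sY" if "P \<in> bounded_ops sX sY" "norm P \<le> e" for P
      unfolding Phi_minus_iff using bounded_ops_add[OF T that(1)] B(1) e(2)[OF that(2)] by blast
  qed
qed

text \<open>
  Let \<open>F\<close> be the span of \<open>B\<close>. Since \<open>S\<close> is not onto modulo \<open>F\<close>, the approximation step
  with constants \<open>1/d\<close> and \<open>1/2\<close> fails at some \<open>y0\<close>. Take for \<open>p y\<close> the infimum, over \<open>x\<close> and \<open>f \<in> F\<close>, of
  \<open>d * norm x + 2 * norm (y - S x - f)\<close>. The failure says that \<open>norm y0 \<le> p y0\<close>: one of the two terms is
  always large. On the other hand \<open>p (S x) \<le> d * norm x\<close>, and \<open>p\<close> vanishes on \<open>F\<close>. A functional bounded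
  by \<open>p\<close> that attains at \<open>y0\<close> at least \<open>p y0\<close> has the required properties, with \<open>y0\<close> normalised to value 1.
\<close>

lemma small_functional_on_range:
  assumes S: "S \<in> bounded_ops sX sY" "S \<notin> Phi_minus sX sY" and "finite B" and d: "0 < d"
  obtains \<phi> y where "\<phi> \<in> bounded_ops sY (*)" "blinfun_apply \<phi> y = 1"
    "\<And>v. v \<in> B \<Longrightarrow> blinfun_apply \<phi> v = 0"
    "\<And>x. norm (blinfun_apply \<phi> (blinfun_apply S x)) * norm y \<le> d * norm x"
proof -
  let ?F = "cod.span B"
  have F: "Real_Vector_Spaces.subspace ?F" "closed ?F"
    using cod.real_subspace[OF cod.subspace_span] cod.closed_span_finite[OF \<open>finite B\<close>] by auto
  have "\<not> (\<forall>y. \<exists>x. \<exists>f\<in>?F. y = blinfun_apply S x + f)"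
    using S \<open>finite B\<close> by (auto simp: Phi_minus_iff)
  then have "\<not> nearly_onto S ?F (1/d) (1/2)"
    using nearly_onto_imp_onto[OF F, of S "1/d" "1/2"] d by auto
  then obtain y0 where y0: "\<And>x f. f \<in> ?F \<Longrightarrow> norm x \<le> 1/d * norm y0 \<Longrightarrow>
      1/2 * norm y0 < norm (y0 - blinfun_apply S x - f)"
    unfolding nearly_onto_def by (meson not_less)
  have "y0 \<noteq> 0"
    using y0[OF cod.span_zero, of 0] by auto
  define val where "val y z = d * norm (fst z) + 2 * norm (y - blinfun_apply S (fst z) - snd z)"
    for y and z :: "'x \<times> 'y"
  define p where "p y = (INF z\<in>UNIV \<times> ?F. val y z)" for y
  have val_nonneg: "0 \<le> val y z" for y z
    using d by (simp add: val_def)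
  have ne: "UNIV \<times> ?F \<noteq> {}"
    using cod.span_zero by auto
  have lower: "p y \<le> val y z" if "snd z \<in> ?F" for y z
    unfolding p_def using that val_nonneg
    by (intro cINF_lower bdd_belowI2[where m = 0]) (auto simp: mem_Times_iff)
  have greatest: "b \<le> p y" if "\<And>z. snd z \<in> ?F \<Longrightarrow> b \<le> val y z" for b y
    unfolding p_def using that ne by (intro cINF_greatest) auto
  have p_nonneg: "0 \<le> p y" for y
    using val_nonneg by (intro greatest)
  have p_add: "p (y + y') \<le> p y + p y'" for y y'
  proof -
    have *: "p (y + y') \<le> val y z + val y' z'" if "snd z \<in> ?F" "snd z' \<in> ?F" for z z'
    proof -
      have "p (y + y') \<le> val (y + y') (z + z')"
        using that by (intro lower) (simp add: cod.span_add)
      also have "\<dots> \<le> val y z + val y' z'"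
      proof -
        have "norm (y + y' - blinfun_apply S (fst (z + z')) - snd (z + z')) \<le>
            norm (y - blinfun_apply S (fst z) - snd z) + norm (y' - blinfun_apply S (fst z') - snd z')"
          by (rule order_trans[OF eq_refl norm_triangle_ineq])
            (simp add: blinfun.add_right algebra_simps)
        moreover have "d * norm (fst (z + z')) \<le> d * norm (fst z) + d * norm (fst z')"
          using d by (simp add: distrib_left[symmetric] norm_triangle_ineq)
        ultimately show ?thesis
          unfolding val_def by linarith
      qed
      finally show ?thesis .
    qed
    have "p (y + y') - val y' z' \<le> p y" if "snd z' \<in> ?F" for z'
      using *[OF _ that] by (intro greatest) (simp add: algebra_simps)
    then have "p (y + y') - p y \<le> p y'"
      by (intro greatest) (simp add: algebra_simps)
    then show ?thesis by simp
  qed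
  have p_le: "p (sY c y) \<le> norm c * p y" for c y
  proof (cases "c = 0")
    case True
    then show ?thesis
      using lower[of 0 0] by (simp add: cod.span_zero val_def)
  next
    case False
    have "p (sY c y) \<le> norm c * val y z" if "snd z \<in> ?F" for z
    proof -
      have "p (sY c y) \<le> val (sY c y) (sX c (fst z), sY c (snd z))"
        using that by (intro lower) (simp add: cod.span_scale)
      also have "\<dots> = norm c * val y z"
        by (simp add: val_def bounded_opsD[OF S(1)] cod.scale_right_diff_distrib[symmetric]
            cod.norm_scale dom.norm_scale distrib_left)
      finally show ?thesis .
    qed
    then have "p (sY c y) / norm c \<le> p y"
      using False by (intro greatest) (simp add: field_simps)
    then show ?thesis
      using False by (simp add: field_simps)
  qed
  have p_hom: "p (sY c y) = norm c * p y" for c y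
  proof (cases "c = 0")
    case True
    then show ?thesis
      using p_le[of c y] p_nonneg[of "sY c y"] by simp
  next
    case False
    then have "norm c * p y \<le> p (sY c y)"
      using p_le[of "inverse c" "sY c y"] by (simp add: norm_divide field_simps)
    then show ?thesis
      using p_le[of c y] by simp
  qed
  have p_norm: "p y \<le> 2 * norm y" for y
    using lower[of 0 y] by (simp add: cod.span_zero val_def)
  have p_y0: "norm y0 \<le> p y0"
  proof (rule greatest)
    fix z :: "'x \<times> 'y" assume z: "snd z \<in> ?F"
    show "norm y0 \<le> val y0 z"
    proof (cases "norm (fst z) \<le> 1/d * norm y0")
      case True
      then have "norm y0 \<le> 2 * norm (y0 - blinfun_apply S (fst z) - snd z)"
        using y0[OF z] by fastforce
      then show ?thesis
        using d by (simp add: val_def add_increasing)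
    next
      case False
      then have "norm y0 \<le> d * norm (fst z)"
        using d by (simp add: field_simps)
      then show ?thesis
        by (simp add: val_def add_increasing2)
    qed
  qed
  obtain \<phi> where \<phi>: "\<phi> \<in> bounded_ops sY (*)" "\<And>y. norm (blinfun_apply \<phi> y) \<le> p y"
      "p y0 \<le> norm (blinfun_apply \<phi> y0)"
    using cod.Hahn_Banach_seminorm[of p 2 y0, OF p_add p_hom p_norm] by blast
  define y where "y = sY (inverse (blinfun_apply \<phi> y0)) y0"
  have "norm y0 \<le> norm (blinfun_apply \<phi> y0)"
    using p_y0 \<phi>(3) by simp
  then have pos: "norm y0 \<le> norm (blinfun_apply \<phi> y0)" "blinfun_apply \<phi> y0 \<noteq> 0"
    using \<open>y0 \<noteq> 0\<close> by auto
  have "norm y \<le> 1"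
    using pos by (simp add: y_def cod.norm_scale norm_divide field_simps)
  show thesis
  proof (rule that[OF \<phi>(1)])
    show "blinfun_apply \<phi> y = 1"
      using pos by (simp add: y_def cod.bounded_ops_functionalD[OF \<phi>(1)])
    show "blinfun_apply \<phi> v = 0" if "v \<in> B" for v
    proof -
      have "p v \<le> 0"
        using lower[of "(0, v)" v] cod.span_base[OF that] by (simp add: val_def)
      then show ?thesis
        using \<phi>(2)[of v] norm_ge_zero[of "blinfun_apply \<phi> v"] by (simp flip: norm_le_zero_iff)
    qed
    show "norm (blinfun_apply \<phi> (blinfun_apply S x)) * norm y \<le> d * norm x" for x
    proof -
      have "norm (blinfun_apply \<phi> (blinfun_apply S x)) \<le> d * norm x"
        using \<phi>(2)[of "blinfun_apply S x"] lower[of "(x, 0)" "blinfun_apply S x"]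
        by (simp add: val_def cod.span_zero)
      then show ?thesis
        using mult_mono[of "norm (blinfun_apply \<phi> (blinfun_apply S x))" "d * norm x" "norm y" 1]
          \<open>norm y \<le> 1\<close> d by simp
    qed
  qed
qed

end

section \<open>Small perturbations with range in an infinite codimensional subspace\<close>

lemma (in banach_over) bounded_linear_scale: "bounded_linear (scale c)"
  by (rule bounded_linear_intro[where K = "norm c"])
    (simp_all add: scale_right_distrib scaleR_eq_scale norm_scale mult.commute)

context operators_between
begin

text \<open>
  A new functional is chosen to vanish on the earlier vectors. Its vector \<open>v\<close> is then corrected by
  its coefficients along the earlier system, which makes it biorthogonal to the earlier functionals and
  multiplies its norm by at most a constant \<open>K\<close> of the earlier system. As \<open>K\<close> is known before the new
  functional is chosen, the bound \<open>e n / K\<close> can be asked for.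
\<close>

lemma small_biorthogonal_system:
  assumes S: "S \<in> bounded_ops sX sY" "S \<notin> Phi_minus sX sY" and e: "\<And>n. 0 < e n"
  obtains \<phi> :: "nat \<Rightarrow> 'y \<Rightarrow>\<^sub>L 'k" and y :: "nat \<Rightarrow> 'y" where
    "\<And>n. \<phi> n \<in> bounded_ops sY (*)"
    "\<And>m n. blinfun_apply (\<phi> m) (y n) = (if m = n then 1 else 0)"
    "\<And>n x. norm (blinfun_apply (\<phi> n) (blinfun_apply S x)) * norm (y n) \<le> e n * norm x"
proof -
  \<comment> \<open>\<open>Q f n r\<close>: the pair \<open>r\<close> of a functional and a vector may continue the pairs \<open>f j\<close> with \<open>j < n\<close>.\<close>
  define Q :: "(nat \<Rightarrow> ('y \<Rightarrow>\<^sub>L 'k) \<times> 'y) \<Rightarrow> nat \<Rightarrow> ('y \<Rightarrow>\<^sub>L 'k) \<times> 'y \<Rightarrow> bool" where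
    "Q f n r \<longleftrightarrow> fst r \<in> bounded_ops sY (*) \<and> blinfun_apply (fst r) (snd r) = 1 \<and>
       (\<forall>j<n. blinfun_apply (fst r) (snd (f j)) = 0 \<and> blinfun_apply (fst (f j)) (snd r) = 0) \<and>
       (\<forall>x. norm (blinfun_apply (fst r) (blinfun_apply S x)) * norm (snd r) \<le> e n * norm x)"
    for f n r
  have "\<exists>f. \<forall>n. Q f n (f n)"
  proof (rule dependent_wellorder_choice)
    show "Q f n r = Q g n r" if "\<And>j. j < n \<Longrightarrow> f j = g j" for r f g n
      using that by (auto simp: Q_def)
    show "\<exists>r. Q f n r" if prev: "\<And>j. j < n \<Longrightarrow> Q f j (f j)" for n f
    proof -
      let ?\<phi> = "\<lambda>j. fst (f j)" and ?y = "\<lambda>j. snd (f j)"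
      have biorth: "blinfun_apply (?\<phi> i) (?y j) = (if i = j then 1 else 0)" if "i < n" "j < n" for i j
        using prev[OF that(1)] prev[OF that(2)] unfolding Q_def
        by (cases i j rule: linorder_cases) auto
      define K where "K = 1 + (\<Sum>j<n. norm (?\<phi> j) * norm (?y j))"
      have "1 \<le> K"
        by (simp add: K_def sum_nonneg)
      obtain \<psi> v where \<psi>: "\<psi> \<in> bounded_ops sY (*)" "blinfun_apply \<psi> v = 1"
        "\<And>w. w \<in> ?y ` {..<n} \<Longrightarrow> blinfun_apply \<psi> w = 0"
        "\<And>x. norm (blinfun_apply \<psi> (blinfun_apply S x)) * norm v \<le> e n / K * norm x"
        using small_functional_on_range[OF S, of "?y ` {..<n}" "e n / K"] e[of n] \<open>1 \<le> K\<close> by auto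
      \<comment> \<open>The vector \<open>v\<close> made biorthogonal to the earlier functionals; \<open>\<psi> w = \<psi> v\<close> as \<open>\<psi>\<close> kills the earlier vectors.\<close>
      define w where "w = v - (\<Sum>j<n. sY (blinfun_apply (?\<phi> j) v) (?y j))"
      have lin: "blinfun_apply \<theta> w = blinfun_apply \<theta> v -
          (\<Sum>j<n. blinfun_apply (?\<phi> j) v * blinfun_apply \<theta> (?y j))"
        if "\<theta> \<in> bounded_ops sY (*)" for \<theta>
        by (simp add: w_def blinfun.diff_right blinfun.sum_right cod.bounded_ops_functionalD[OF that])
      have "norm w \<le> norm v + (\<Sum>j<n. norm (sY (blinfun_apply (?\<phi> j) v) (?y j)))"
        unfolding w_def by (rule order_trans[OF norm_triangle_ineq4]) (simp add: norm_sum)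
      also have "\<dots> \<le> norm v + (\<Sum>j<n. norm (?\<phi> j) * norm (?y j) * norm v)"
      proof (intro add_left_mono sum_mono)
        fix j
        show "norm (sY (blinfun_apply (?\<phi> j) v) (?y j)) \<le> norm (?\<phi> j) * norm (?y j) * norm v"
          using mult_right_mono[OF norm_blinfun[of "?\<phi> j" v] norm_ge_zero[of "?y j"]]
          by (simp add: cod.norm_scale mult_ac)
      qed
      also have "\<dots> = K * norm v"
        by (simp add: K_def distrib_right sum_distrib_right)
      finally have "norm w \<le> K * norm v" .
      have "Q f n (\<psi>, w)"
        unfolding Q_def fst_conv snd_conv
      proof (intro conjI allI impI)
        show "\<psi> \<in> bounded_ops sY (*)"
          by (rule \<psi>(1))
        show "blinfun_apply \<psi> w = 1"
          using lin[OF \<psi>(1)] \<psi>(2,3) by simp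
        show "blinfun_apply \<psi> (?y j) = 0" if "j < n" for j
          using \<psi>(3) that by simp
        show "blinfun_apply (?\<phi> i) w = 0" if "i < n" for i
        proof -
          have "?\<phi> i \<in> bounded_ops sY (*)"
            using prev[OF that] by (simp add: Q_def)
          moreover have "(\<Sum>j<n. blinfun_apply (?\<phi> j) v * blinfun_apply (?\<phi> i) (?y j))
              = (\<Sum>j<n. if i = j then blinfun_apply (?\<phi> j) v else 0)"
            using biorth[OF that] by (intro sum.cong) auto
          ultimately show ?thesis
            using lin that by simp
        qed
        show "norm (blinfun_apply \<psi> (blinfun_apply S x)) * norm w \<le> e n * norm x" for x
        proof -
          have "norm (blinfun_apply \<psi> (blinfun_apply S x)) * norm w
              \<le> norm (blinfun_apply \<psi> (blinfun_apply S x)) * (K * norm v)"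
            using \<open>norm w \<le> K * norm v\<close> by (rule mult_left_mono) simp
          also have "\<dots> = K * (norm (blinfun_apply \<psi> (blinfun_apply S x)) * norm v)"
            by (simp only: mult_ac)
          also have "\<dots> \<le> K * (e n / K * norm x)"
            using \<psi>(4) \<open>1 \<le> K\<close> by (intro mult_left_mono) auto
          finally show ?thesis
            using \<open>1 \<le> K\<close> by simp
        qed
      qed
      then show ?thesis ..
    qed
  qed
  then obtain f where f: "Q f n (f n)" for n
    by blast
  show thesis
  proof (rule that)
    show "fst (f n) \<in> bounded_ops sY (*)" for n
      using f[of n] by (simp add: Q_def)
    show "blinfun_apply (fst (f m)) (snd (f n)) = (if m = n then 1 else 0)" for m n
      using f[of m] f[of n] unfolding Q_def by (cases m n rule: linorder_cases) auto
    show "norm (blinfun_apply (fst (f n)) (blinfun_apply S x)) * norm (snd (f n)) \<le> e n * norm x" for n x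
      using f[of n] by (simp add: Q_def)
  qed
qed

text \<open>
  The operator \<open>D x = (\<Sum>n. \<phi> n (S x) (y n))\<close> agrees with \<open>S\<close> under every \<open>\<phi> m\<close>, so \<open>S - D\<close> maps into the
  common kernel of the functionals.
\<close>

lemma small_perturbation_infinite_codim:
  assumes S: "S \<in> bounded_ops sX sY" "S \<notin> Phi_minus sX sY" and e: "0 < e"
  obtains C N where "C \<in> bounded_ops sX sY" "norm C \<le> e"
    "closed_subspace sY N" "\<not> finite_codim sY N" "\<And>x. blinfun_apply (S + C) x \<in> N"
proof -
  obtain \<phi> y where \<phi>: "\<And>n. \<phi> n \<in> bounded_ops sY (*)"
    and biorth: "\<And>m n. blinfun_apply (\<phi> m) (y n) = (if m = n then 1 else 0)"
    and small: "\<And>n x. norm (blinfun_apply (\<phi> n) (blinfun_apply S x)) * norm (y n)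
        \<le> e * (1/2) ^ Suc n * norm x"
    using small_biorthogonal_system[OF S, of "\<lambda>n. e * (1/2) ^ Suc n"] e by auto
  \<comment> \<open>The weights sum to \<open>e\<close>, which bounds the norm of the resulting series.\<close>
  define c where "c n x = sY (blinfun_apply (\<phi> n) (blinfun_apply S x)) (y n)" for n x
  define D where "D x = (\<Sum>n. c n x)" for x
  have sums: "(\<lambda>n. e * (1/2) ^ Suc n * norm x) sums (norm x * e)" for x :: 'x
    using sums_mult[OF power_half_series, of "e * norm x"] by (simp add: mult_ac)
  have c_le: "norm (c n x) \<le> e * (1/2) ^ Suc n * norm x" for n x
    using small[of n x] by (simp add: c_def cod.norm_scale)
  have summable: "summable (\<lambda>n. c n x)" for x
    by (rule summable_comparison_test'[OF sums_summable[OF sums] c_le])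
  have D_le: "norm (D x) \<le> norm x * e" for x
    unfolding D_def using norm_suminf_le[OF c_le sums_summable[OF sums]] sums_unique[OF sums] by metis
  have D_add: "D (x + x') = D x + D x'" for x x'
    unfolding D_def suminf_add[OF summable summable]
    by (simp add: c_def blinfun.add_right cod.scale_left_distrib)
  have D_scale: "D (sX k x) = sY k (D x)" for k x
    unfolding D_def bounded_linear.suminf[OF cod.bounded_linear_scale summable]
    by (simp add: c_def bounded_opsD[OF S(1)] cod.bounded_ops_functionalD[OF \<phi>])
  have bl: "bounded_linear D"
    using D_add D_le by (intro bounded_linear_intro) (auto simp: dom.scaleR_eq_scale cod.scaleR_eq_scale D_scale)
  have \<phi>D: "blinfun_apply (\<phi> m) (D x) = blinfun_apply (\<phi> m) (blinfun_apply S x)" for m x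
  proof -
    have "blinfun_apply (\<phi> m) (D x) = (\<Sum>n. blinfun_apply (\<phi> m) (c n x))"
      unfolding D_def by (rule bounded_linear.suminf[OF blinfun.bounded_linear_right summable])
    also have "\<dots> = (\<Sum>n. if n = m then blinfun_apply (\<phi> n) (blinfun_apply S x) else 0)"
      by (intro suminf_cong) (simp add: c_def cod.bounded_ops_functionalD[OF \<phi>] biorth)
    finally show ?thesis
      using sums_unique[OF sums_single[of m "\<lambda>n. blinfun_apply (\<phi> n) (blinfun_apply S x)"]] by simp
  qed
  let ?N = "{v. \<forall>n\<in>UNIV. blinfun_apply (\<phi> n) v = 0}"
  have N: "cod.subspace ?N"
    by (rule cod.subspace_kernel[OF \<phi>])
  show thesis
  proof (rule that[of "- Blinfun D" ?N])
    show "- Blinfun D \<in> bounded_ops sX sY"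
      by (intro bounded_ops_uminus) (simp add: bounded_ops_def bounded_linear_Blinfun_apply[OF bl] D_scale)
    show "norm (- Blinfun D) \<le> e"
      using e D_le by (simp add: norm_blinfun_bound bounded_linear_Blinfun_apply[OF bl] mult.commute)
    show "closed_subspace sY ?N"
      unfolding closed_subspace_def using N cod.closed_kernel by blast
    show "\<not> finite_codim sY ?N"
      by (rule cod.biorthogonal_imp_not_finite_codim[OF \<phi> biorth N]) auto
    show "blinfun_apply (S + - Blinfun D) x \<in> ?N" for x
      by (simp add: blinfun.diff_left bounded_linear_Blinfun_apply[OF bl] blinfun.diff_right \<phi>D)
  qed
qed

end

section \<open>Invertible translates of an operator\<close>

context banach_over
begin

text \<open>
  For \<open>r > norm A\<close> the operator \<open>E = A + r\<close> is bounded below, hence injective with bounded inverse on its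
  range, and \<open>y / r\<close> is an approximate preimage of \<open>y\<close>, so that \<open>E\<close> is onto by successive
  approximation. The choice \<open>r = 2 * (norm A + 1)\<close> makes the error at most one half.
\<close>

lemma shift_by_large_scalar_invertible:
  assumes A: "A \<in> bounded_ops scale scale"
  obtains R r where "R \<in> bounded_ops scale scale"
    "\<And>x. blinfun_apply R (blinfun_apply A x + r *\<^sub>R x) = x"
    "\<And>x. blinfun_apply A (blinfun_apply R x) + r *\<^sub>R blinfun_apply R x = x"
proof -
  define r where "r = 2 * (norm A + 1)"
  have "0 < r"
    unfolding r_def by (intro mult_pos_pos add_nonneg_pos) simp_all
  define E where "E = A + r *\<^sub>R id_blinfun"
  have E: "blinfun_apply E x = blinfun_apply A x + r *\<^sub>R x" for x
    by (simp add: E_def blinfun.add_left blinfun.scaleR_left)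
  have A_le: "norm (blinfun_apply A x) \<le> r / 2 * norm x" for x
  proof -
    have "norm (blinfun_apply A x) \<le> norm A * norm x"
      by (rule norm_blinfun)
    also have "\<dots> \<le> r / 2 * norm x"
      by (intro mult_right_mono) (simp_all add: r_def)
    finally show ?thesis .
  qed
  have lower: "r / 2 * norm x \<le> norm (blinfun_apply E x)" for x
    using norm_triangle_ineq2[of "r *\<^sub>R x" "- blinfun_apply A x"] A_le[of x] \<open>0 < r\<close>
    by (simp add: E add.commute)
  have "nearly_onto E {0} (1 / r) (1/2)"
    unfolding nearly_onto_def
  proof
    fix y
    have "y - blinfun_apply E (inverse r *\<^sub>R y) = - (inverse r *\<^sub>R blinfun_apply A y)"
      using \<open>0 < r\<close> by (simp add: E blinfun.scaleR_right scaleR_add_right)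
    then have "norm (y - blinfun_apply E (inverse r *\<^sub>R y)) = inverse r * norm (blinfun_apply A y)"
      using \<open>0 < r\<close> by simp
    also have "\<dots> \<le> inverse r * (r / 2 * norm y)"
      using \<open>0 < r\<close> A_le by (intro mult_left_mono) auto
    also have "\<dots> = 1/2 * norm y"
      using \<open>0 < r\<close> by (simp add: field_simps)
    finally show "\<exists>x. \<exists>f\<in>{0}. norm x \<le> 1 / r * norm y \<and> norm (y - blinfun_apply E x - f) \<le> 1/2 * norm y"
      using \<open>0 < r\<close> by (intro exI[of _ "inverse r *\<^sub>R y"]) (simp add: field_simps)
  qed
  then have surj: "\<exists>x. y = blinfun_apply E x" for y
    using nearly_onto_imp_onto[of "{0}" E "1 / r" "1/2" y] \<open>0 < r\<close> by (auto simp: subspace_def)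
  have inj: "x = x'" if "blinfun_apply E x = blinfun_apply E x'" for x x'
    using lower[of "x - x'"] that \<open>0 < r\<close> by (simp add: blinfun.diff_right mult_le_0_iff)
  obtain g where g: "blinfun_apply E (g y) = y" for y
    using surj by metis
  have g_add: "g (x + y) = g x + g y" for x y
    by (rule inj) (simp add: g blinfun.add_right)
  have E_scale: "blinfun_apply E (scale c x) = scale c (blinfun_apply E x)" for c x
    using A by (simp add: E bounded_ops_def scale_right_distrib scaleR_eq_scale mult.commute)
  have g_scale: "g (scale c x) = scale c (g x)" for c x
    by (rule inj) (simp add: g E_scale)
  have bl: "bounded_linear g"
  proof (rule bounded_linear_intro)
    show "norm (g x) \<le> norm x * (2 / r)" for x
      using lower[of "g x"] \<open>0 < r\<close> by (simp add: g field_simps)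
  qed (simp_all add: g_add g_scale scaleR_eq_scale)
  show thesis
  proof (rule that[of "Blinfun g" r])
    show "Blinfun g \<in> bounded_ops scale scale"
      by (simp add: bounded_ops_def bounded_linear_Blinfun_apply[OF bl] g_scale)
    show "blinfun_apply (Blinfun g) (blinfun_apply A x + r *\<^sub>R x) = x" for x
      using g inj by (simp add: bounded_linear_Blinfun_apply[OF bl] E[symmetric])
    show "blinfun_apply A (blinfun_apply (Blinfun g) x) + r *\<^sub>R blinfun_apply (Blinfun g) x = x" for x
      using g by (simp add: bounded_linear_Blinfun_apply[OF bl] E[symmetric])
  qed
qed

end

section \<open>Cosingular operators and the perturbation class\<close>

context operators_between
begin

interpretation pair: operators_between "prod_scale sX" sY
  by (simp add: operators_between_def banach_over_prod_scale dom.banach_over_axioms cod.banach_over_axioms)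

lemma pair_op_bounded_ops:
  assumes "S \<in> bounded_ops sX sY" "K \<in> bounded_ops sX sY"
  shows "pair_op S K \<in> bounded_ops (prod_scale sX) sY"
  using assms
  by (auto simp: bounded_ops_def prod_scale_def pair_op_apply cod.scale_right_distrib)

lemma pair_op_Phi_minus_iff:
  assumes "S \<in> bounded_ops sX sY" "K \<in> bounded_ops sX sY"
  shows "pair_op S K \<in> Phi_minus (prod_scale sX) sY \<longleftrightarrow>
    (\<exists>B. finite B \<and> (\<forall>y. \<exists>x x'. \<exists>f\<in>cod.span B. y = blinfun_apply S x + blinfun_apply K x' + f))"
  by (simp add: pair.Phi_minus_iff pair_op_bounded_ops[OF assms] pair_op_apply)

text \<open>
  Strict cosingularity tolerates a finite-dimensional defect: \<open>span (N \<union> B)\<close> is closed and infinite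
  codimensional whenever \<open>N\<close> is.
\<close>

lemma strictly_cosingularD:
  assumes K: "K \<in> strictly_cosingular sX sY" and N: "closed_subspace sY N" and "finite B"
    and onto: "\<And>y. \<exists>n\<in>N. \<exists>x. \<exists>f\<in>cod.span B. y = n + blinfun_apply K x + f"
  shows "finite_codim sY N"
proof (rule ccontr)
  assume inf: "\<not> finite_codim sY N"
  have sub: "cod.subspace N" and "closed N"
    using N by (auto simp: closed_subspace_def)
  let ?N = "cod.span (N \<union> B)"
  have "closed_subspace sY ?N"
    unfolding closed_subspace_def
    using cod.closed_span_Un_finite[OF _ \<open>finite B\<close>, of N] \<open>closed N\<close> sub
    by (simp add: cod.span_eq_iff[THEN iffD2])
  moreover have "\<not> finite_codim sY ?N"
    using cod.finite_codim_span_Un_finite[OF sub \<open>finite B\<close>] inf by blast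
  moreover have "range (quot_map ?N \<circ> blinfun_apply K) = quot_space ?N"
  proof -
    have "\<exists>x. quot_map ?N y = quot_map ?N (blinfun_apply K x)" for y
    proof -
      obtain n x f where "n \<in> N" "f \<in> cod.span B" "y = n + blinfun_apply K x + f"
        using onto by blast
      then have "y - blinfun_apply K x \<in> ?N"
        using cod.span_Un_subspace_left[OF sub, of "y - blinfun_apply K x" B]
        by (auto intro!: bexI[of _ f])
      then show ?thesis
        using cod.quot_map_eq_iff[OF cod.subspace_span] by blast
    qed
    then show ?thesis
      unfolding quot_space_def by (auto simp: image_iff)
  qed
  ultimately show False
    using K unfolding strictly_cosingular_def by blast
qed

text \<open>
  Replacing \<open>S\<close> by a small perturbation \<open>S + C\<close> with range in an infinite codimensional closed \<open>N\<close> keeps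
  \<open>[S, K]\<close> lower semi-Fredholm, and then \<open>K\<close> is onto modulo \<open>N\<close> up to finite dimension.
\<close>

theorem strictly_cosingular_subset_Phi_cosingular:
  "strictly_cosingular sX sY \<subseteq> Phi_cosingular sX sY"
proof
  fix K assume K: "K \<in> strictly_cosingular sX sY"
  then have K_op: "K \<in> bounded_ops sX sY"
    by (simp add: strictly_cosingular_def)
  have "S \<in> Phi_minus sX sY"
    if S: "S \<in> bounded_ops sX sY" and SK: "pair_op S K \<in> Phi_minus (prod_scale sX) sY" for S
  proof (rule ccontr)
    assume "S \<notin> Phi_minus sX sY"
    obtain e where e: "0 < e" "\<And>P. P \<in> bounded_ops (prod_scale sX) sY \<Longrightarrow> norm P \<le> e \<Longrightarrow>
        pair_op S K + P \<in> Phi_minus (prod_scale sX) sY"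
      using pair.Phi_minus_open[OF SK] by blast
    obtain C N where C: "C \<in> bounded_ops sX sY" "norm C \<le> e"
      and N: "closed_subspace sY N" "\<not> finite_codim sY N" "\<And>x. blinfun_apply (S + C) x \<in> N"
      using small_perturbation_infinite_codim[OF S \<open>S \<notin> Phi_minus sX sY\<close> e(1)] by blast
    have zero: "0 \<in> bounded_ops sX sY"
      by (simp add: bounded_ops_def)
    have "norm (pair_op C 0) \<le> e"
    proof (rule norm_blinfun_bound)
      fix z :: "'x \<times> 'x"
      have "norm (blinfun_apply C (fst z)) \<le> norm C * norm (fst z)"
        by (rule norm_blinfun)
      also have "\<dots> \<le> e * norm z"
        using C(2) e(1) norm_fst_le[of "fst z" "snd z"] by (intro mult_mono) auto
      finally show "norm (blinfun_apply (pair_op C 0) z) \<le> e * norm z"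
        by (simp add: pair_op_apply[of C 0 "fst z" "snd z", simplified])
    qed (use e in simp)
    then have "pair_op S K + pair_op C 0 \<in> Phi_minus (prod_scale sX) sY"
      by (intro e(2) pair_op_bounded_ops C(1) zero)
    moreover have "pair_op S K + pair_op C 0 = pair_op (S + C) K"
      by (rule blinfun_eqI) (simp add: pair_op_def blinfun.add_left)
    ultimately obtain B where B: "finite B"
        "\<And>y. \<exists>x x'. \<exists>f\<in>cod.span B. y = blinfun_apply (S + C) x + blinfun_apply K x' + f"
      using pair_op_Phi_minus_iff[OF bounded_ops_add[OF S C(1)] K_op] by auto
    have "finite_codim sY N"
      using B(2) N(3) by (intro strictly_cosingularD[OF K N(1) B(1)]) blast
    with N(2) show False ..
  qed
  with K_op show "K \<in> Phi_cosingular sX sY"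
    by (simp add: Phi_cosingular_def)
qed

text \<open>
  Compose the quotient map, which does not increase norms, with the isomorphism.
\<close>

lemma quotient_isomorphism_imp_range:
  assumes M: "closed_subspace sX M" and iso: "isomorphic_to_quotient sY N sX M"
  obtains S where "S \<in> bounded_ops sX sY" "range (blinfun_apply S) = N"
proof -
  obtain f C where f: "bij_betw f (quot_space M) N"
    and f_add: "\<And>x y. f (quot_map M (x + y)) = f (quot_map M x) + f (quot_map M y)"
    and f_scale: "\<And>c x. f (quot_map M (sX c x)) = sY c (f (quot_map M x))"
    and f_le: "\<And>q. q \<in> quot_space M \<Longrightarrow> norm (f q) \<le> C * quot_norm q"
    using iso unfolding isomorphic_to_quotient_def by blast
  have "0 \<in> M"
    using M dom.subspace_0 by (auto simp: closed_subspace_def)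
  have qn: "0 \<le> quot_norm (quot_map M x)" "quot_norm (quot_map M x) \<le> norm x" for x
  proof -
    have x: "x \<in> quot_map M x"
      using \<open>0 \<in> M\<close> by (auto simp: quot_map_def image_iff intro!: bexI[of _ 0])
    then show "0 \<le> quot_norm (quot_map M x)"
      unfolding quot_norm_def by (intro cINF_greatest) auto
    show "quot_norm (quot_map M x) \<le> norm x"
      unfolding quot_norm_def using x by (intro cINF_lower bdd_belowI2[where m = 0]) auto
  qed
  let ?g = "\<lambda>x. f (quot_map M x)"
  have bl: "bounded_linear ?g"
  proof (rule bounded_linear_intro)
    fix x
    have "norm (?g x) \<le> C * quot_norm (quot_map M x)"
      by (rule f_le) (simp add: quot_space_def)
    also have "\<dots> \<le> \<bar>C\<bar> * norm x"
      using qn[of x] by (intro mult_mono) auto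
    finally show "norm (?g x) \<le> norm x * \<bar>C\<bar>"
      by (simp add: mult.commute)
  qed (simp_all add: f_add f_scale dom.scaleR_eq_scale cod.scaleR_eq_scale)
  show thesis
  proof (rule that[of "Blinfun ?g"])
    show "Blinfun ?g \<in> bounded_ops sX sY"
      by (simp add: bounded_ops_def bounded_linear_Blinfun_apply[OF bl] f_scale)
    show "range (blinfun_apply (Blinfun ?g)) = N"
      using bij_betw_imp_surj_on[OF f]
      by (simp add: bounded_linear_Blinfun_apply[OF bl] quot_space_def image_image)
  qed
qed

text \<open>
  An operator \<open>S\<close> with range \<open>N \<supseteq> L\<close> complements \<open>K\<close> to an onto pair \<open>[S, K]\<close> if \<open>K\<close> is onto modulo \<open>L\<close>, although
  \<open>S\<close> itself has infinite codimensional range.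
\<close>

theorem Phi_cosingular_subset_strictly_cosingular:
  assumes ext: "\<And>L. closed_subspace sY L \<Longrightarrow> \<not> finite_codim sY L \<Longrightarrow>
    \<exists>N. L \<subseteq> N \<and> closed_subspace sY N \<and> \<not> finite_codim sY N \<and>
        (\<exists>M. closed_subspace sX M \<and> isomorphic_to_quotient sY N sX M)"
  shows "Phi_cosingular sX sY \<subseteq> strictly_cosingular sX sY"
proof
  fix K assume K: "K \<in> Phi_cosingular sX sY"
  then have K_op: "K \<in> bounded_ops sX sY"
    by (simp add: Phi_cosingular_def)
  have False if L: "closed_subspace sY L" "\<not> finite_codim sY L"
    and surj: "range (quot_map L \<circ> blinfun_apply K) = quot_space L" for L
  proof -
    obtain N M where N: "L \<subseteq> N" "closed_subspace sY N" "\<not> finite_codim sY N"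
      and M: "closed_subspace sX M" "isomorphic_to_quotient sY N sX M"
      using ext[OF L] by blast
    obtain S where S: "S \<in> bounded_ops sX sY" "range (blinfun_apply S) = N"
      by (rule quotient_isomorphism_imp_range[OF M])
    have "\<exists>x x'. \<exists>f\<in>cod.span {}. y = blinfun_apply S x + blinfun_apply K x' + f" for y
    proof -
      have "quot_map L y \<in> range (quot_map L \<circ> blinfun_apply K)"
        unfolding surj quot_space_def by simp
      then obtain x' where "quot_map L y = quot_map L (blinfun_apply K x')"
        by auto
      then have "y - blinfun_apply K x' \<in> L"
        using L(1) cod.quot_map_eq_iff by (simp add: closed_subspace_def)
      then obtain x where "y - blinfun_apply K x' = blinfun_apply S x"
        using N(1) S(2) by blast
      then show ?thesis
        by (auto simp: diff_eq_eq)
    qed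
    then have "pair_op S K \<in> Phi_minus (prod_scale sX) sY"
      using pair_op_Phi_minus_iff[OF S(1) K_op] by blast
    then have "S \<in> Phi_minus sX sY"
      using K S(1) by (simp add: Phi_cosingular_def)
    then show False
      using N(3) S(2) by (simp add: Phi_minus_def)
  qed
  with K_op show "K \<in> strictly_cosingular sX sY"
    unfolding strictly_cosingular_def by blast
qed

text \<open>
  Since \<open>(T + K) x + K (- x) = T x\<close>, the range of \<open>[T + K, K]\<close> contains that of \<open>T\<close>.
\<close>

theorem Phi_cosingular_subset_perturbation_class:
  "Phi_cosingular sX sY \<subseteq> perturbation_class sX sY"
proof
  fix K assume K: "K \<in> Phi_cosingular sX sY"
  then have K_op: "K \<in> bounded_ops sX sY"
    by (simp add: Phi_cosingular_def)
  have "T + K \<in> Phi_minus sX sY" if T: "T \<in> Phi_minus sX sY" for T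
  proof -
    obtain B where T_op: "T \<in> bounded_ops sX sY" and B: "finite B"
        "\<And>y. \<exists>x. \<exists>f\<in>cod.span B. y = blinfun_apply T x + f"
      using T by (auto simp: Phi_minus_iff)
    have "\<exists>x x'. \<exists>f\<in>cod.span B. y = blinfun_apply (T + K) x + blinfun_apply K x' + f" for y
    proof -
      obtain x f where "f \<in> cod.span B" "y = blinfun_apply T x + f"
        using B(2) by blast
      then show ?thesis
        by (intro exI[of _ x] exI[of _ "- x"] bexI[of _ f])
          (simp_all add: blinfun.add_left blinfun.minus_right)
    qed
    then have "pair_op (T + K) K \<in> Phi_minus (prod_scale sX) sY"
      using pair_op_Phi_minus_iff[OF bounded_ops_add[OF T_op K_op] K_op] B(1) by blast
    then show ?thesis
      using K bounded_ops_add[OF T_op K_op] by (simp add: Phi_cosingular_def)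
  qed
  with K_op show "K \<in> perturbation_class sX sY"
    by (simp add: perturbation_class_def)
qed

lemma bounded_ops_compose:
  "T \<in> bounded_ops sX sY \<Longrightarrow> A \<in> bounded_ops sX sX \<Longrightarrow> T o\<^sub>L A \<in> bounded_ops sX sY"
  by (simp add: bounded_ops_def)

lemma Phi_minus_scaleR:
  assumes "T \<in> Phi_minus sX sY" "r \<noteq> 0"
  shows "r *\<^sub>R T \<in> Phi_minus sX sY"
proof (rule Phi_minus_mono_range[OF assms(1)])
  show "r *\<^sub>R T \<in> bounded_ops sX sY"
    using assms(1) by (simp add: Phi_minus_def bounded_ops_def blinfun.scaleR_left cod.scaleR_eq_scale mult.commute)
  show "range (blinfun_apply T) \<subseteq> range (blinfun_apply (r *\<^sub>R T))"
  proof
    fix y assume "y \<in> range (blinfun_apply T)"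
    then obtain x where "y = blinfun_apply T x" by blast
    then have "y = blinfun_apply (r *\<^sub>R T) (inverse r *\<^sub>R x)"
      using assms(2) by (simp add: blinfun.scaleR_left blinfun.scaleR_right)
    then show "y \<in> range (blinfun_apply (r *\<^sub>R T))" by blast
  qed
qed

lemma perturbation_class_scaleR:
  assumes K: "K \<in> perturbation_class sX sY" and T: "T \<in> Phi_minus sX sY"
  shows "T + r *\<^sub>R K \<in> Phi_minus sX sY"
proof (cases "r = 0")
  case False
  then have "inverse r *\<^sub>R T + K \<in> Phi_minus sX sY"
    using K Phi_minus_scaleR[OF T, of "inverse r"] by (simp add: perturbation_class_def)
  then have "r *\<^sub>R (inverse r *\<^sub>R T + K) \<in> Phi_minus sX sY"
    using False by (rule Phi_minus_scaleR)
  then show ?thesis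
    using False by (simp add: scaleR_add_right)
qed (simp add: T)

text \<open>
  Let \<open>R\<close> be the inverse of \<open>A + r\<close>. Then \<open>(T + K A) R = (T - r K) R + K\<close>. Here \<open>T - r K\<close> is lower
  semi-Fredholm, composition with the bijection \<open>R\<close> keeps the range, and adding \<open>K\<close> is harmless.
\<close>

lemma perturbation_class_compose:
  assumes K: "K \<in> perturbation_class sX sY" and A: "A \<in> bounded_ops sX sX" and T: "T \<in> Phi_minus sX sY"
  shows "T + (K o\<^sub>L A) \<in> Phi_minus sX sY"
proof -
  have K_op: "K \<in> bounded_ops sX sY" and T_op: "T \<in> bounded_ops sX sY"
    using K T by (auto simp: perturbation_class_def Phi_minus_def)
  obtain R r where R: "R \<in> bounded_ops sX sX"
    "\<And>x. blinfun_apply R (blinfun_apply A x + r *\<^sub>R x) = x"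
    "\<And>x. blinfun_apply A (blinfun_apply R x) + r *\<^sub>R blinfun_apply R x = x"
    using dom.shift_by_large_scalar_invertible[OF A] by blast
  have KA_op: "K o\<^sub>L A \<in> bounded_ops sX sY"
    using K_op A by (rule bounded_ops_compose)
  have "T + r *\<^sub>R (- K) \<in> Phi_minus sX sY"
    using perturbation_class_scaleR[OF K T, of "- r"] by simp
  then have "T - r *\<^sub>R K \<in> Phi_minus sX sY" by simp
  then have TR: "(T - r *\<^sub>R K) o\<^sub>L R \<in> Phi_minus sX sY"
  proof (rule Phi_minus_mono_range)
    show "(T - r *\<^sub>R K) o\<^sub>L R \<in> bounded_ops sX sY"
      using \<open>T - r *\<^sub>R K \<in> Phi_minus sX sY\<close> R(1) by (intro bounded_ops_compose) (auto simp: Phi_minus_def)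
    show "range (blinfun_apply (T - r *\<^sub>R K)) \<subseteq> range (blinfun_apply ((T - r *\<^sub>R K) o\<^sub>L R))"
    proof safe
      fix x
      have "blinfun_apply (T - r *\<^sub>R K) x =
          blinfun_apply ((T - r *\<^sub>R K) o\<^sub>L R) (blinfun_apply A x + r *\<^sub>R x)"
        using R(2) by simp
      then show "blinfun_apply (T - r *\<^sub>R K) x \<in> range (blinfun_apply ((T - r *\<^sub>R K) o\<^sub>L R))"
        by blast
    qed
  qed
  have "((T - r *\<^sub>R K) o\<^sub>L R) + K \<in> Phi_minus sX sY"
    using K TR by (simp add: perturbation_class_def)
  then show ?thesis
  proof (rule Phi_minus_mono_range)
    show "T + (K o\<^sub>L A) \<in> bounded_ops sX sY"
      using T_op KA_op by (rule bounded_ops_add)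
    show "range (blinfun_apply (((T - r *\<^sub>R K) o\<^sub>L R) + K)) \<subseteq> range (blinfun_apply (T + (K o\<^sub>L A)))"
    proof safe
      fix x
      have "blinfun_apply K x = blinfun_apply K (blinfun_apply A (blinfun_apply R x) + r *\<^sub>R blinfun_apply R x)"
        by (simp add: R(3))
      then have "blinfun_apply (((T - r *\<^sub>R K) o\<^sub>L R) + K) x = blinfun_apply (T + (K o\<^sub>L A)) (blinfun_apply R x)"
        by (simp add: blinfun.add_left blinfun.diff_left blinfun.scaleR_left blinfun.add_right blinfun.scaleR_right)
      then show "blinfun_apply (((T - r *\<^sub>R K) o\<^sub>L R) + K) x \<in> range (blinfun_apply (T + (K o\<^sub>L A)))"
        by simp
    qed
  qed
qed

text \<open>
  Transported to \<open>X\<close> by the isomorphism, \<open>[S, K]\<close> becomes the sum of \<open>S (fst V)\<close> and \<open>K (snd V)\<close>, and the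
  second summand can be removed by \<open>perturbation_class_compose\<close>.
\<close>

theorem perturbation_class_subset_Phi_cosingular:
  assumes iso: "isomorphic (prod_scale sX) sX"
  shows "perturbation_class sX sY \<subseteq> Phi_cosingular sX sY"
proof
  fix K assume K: "K \<in> perturbation_class sX sY"
  then have K_op: "K \<in> bounded_ops sX sY"
    by (simp add: perturbation_class_def)
  obtain U where U: "U \<in> bounded_ops (prod_scale sX) sX" "bij (blinfun_apply U)"
      "bounded_linear (inv (blinfun_apply U))"
    using iso by (auto simp: isomorphic_def)
  define V where "V = Blinfun (inv (blinfun_apply U))"
  have UV: "blinfun_apply U (blinfun_apply V x) = x" "blinfun_apply V (blinfun_apply U z) = z" for x z
    using U(2) by (simp_all add: V_def bounded_linear_Blinfun_apply[OF U(3)] bij_is_surj surj_f_inv_f bij_is_inj)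
  have V_scale: "blinfun_apply V (sX c x) = prod_scale sX c (blinfun_apply V x)" for c x
    using U(1) UV by (metis (mono_tags, lifting) bounded_ops_def mem_Collect_eq)
  have A: "fst_blinfun o\<^sub>L V \<in> bounded_ops sX sX" "snd_blinfun o\<^sub>L V \<in> bounded_ops sX sX"
    by (simp_all add: bounded_ops_def V_scale prod_scale_def)
  have "S \<in> Phi_minus sX sY"
    if S: "S \<in> bounded_ops sX sY" and SK: "pair_op S K \<in> Phi_minus (prod_scale sX) sY" for S
  proof -
    let ?S = "S o\<^sub>L (fst_blinfun o\<^sub>L V)" and ?K = "K o\<^sub>L (snd_blinfun o\<^sub>L V)"
    have apply_sum: "blinfun_apply (?S + ?K) x = blinfun_apply (pair_op S K) (blinfun_apply V x)" for x
      by (simp add: pair_op_def blinfun.add_left)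
    have "?S + ?K \<in> bounded_ops sX sY"
      by (intro bounded_ops_add bounded_ops_compose S K_op A)
    moreover obtain B where "finite B" "\<And>y. \<exists>z. \<exists>f\<in>cod.span B. y = blinfun_apply (pair_op S K) z + f"
      using SK by (auto simp: pair.Phi_minus_iff)
    then have "\<exists>B. finite B \<and> (\<forall>y. \<exists>x. \<exists>f\<in>cod.span B. y = blinfun_apply (?S + ?K) x + f)"
      unfolding apply_sum using UV(2) by metis
    ultimately have "?S + ?K \<in> Phi_minus sX sY"
      by (simp add: Phi_minus_iff)
    moreover have "- (snd_blinfun o\<^sub>L V) \<in> bounded_ops sX sX"
      using A(2) by (simp add: bounded_ops_def blinfun.minus_left)
    ultimately have "(?S + ?K) + (K o\<^sub>L - (snd_blinfun o\<^sub>L V)) \<in> Phi_minus sX sY"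
      using perturbation_class_compose[OF K] by blast
    also have "(?S + ?K) + (K o\<^sub>L - (snd_blinfun o\<^sub>L V)) = ?S"
      by (rule blinfun_eqI) (simp add: blinfun.add_left blinfun.minus_left blinfun.minus_right)
    finally show ?thesis
      by (rule Phi_minus_mono_range[OF _ S]) auto
  qed
  with K_op show "K \<in> Phi_cosingular sX sY"
    by (simp add: Phi_cosingular_def)
qed

end

theorem theorem4p4:
  fixes sX :: "'k::{real_normed_field,euclidean_space} \<Rightarrow> 'x::banach \<Rightarrow> 'x"
    and sY :: "'k \<Rightarrow> 'y::banach \<Rightarrow> 'y"
  assumes "banach_over sX" and "banach_over sY"
    and "Phi_minus sX sY \<noteq> {}"
  shows "(isomorphic (prod_scale sX) sX \<longrightarrow>
            Phi_cosingular sX sY = perturbation_class sX sY) \<and>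
         ((\<forall>L. closed_subspace sY L \<and> \<not> finite_codim sY L \<longrightarrow>
             (\<exists>N. L \<subseteq> N \<and> closed_subspace sY N \<and> \<not> finite_codim sY N \<and>
                  (\<exists>M. closed_subspace sX M \<and> isomorphic_to_quotient sY N sX M))) \<longrightarrow>
            Phi_cosingular sX sY = strictly_cosingular sX sY)"
proof -
  interpret operators_between sX sY
    by (intro operators_between.intro assms)
  show ?thesis
  proof (intro conjI impI equalityI)
    show "Phi_cosingular sX sY \<subseteq> perturbation_class sX sY"
      by (rule Phi_cosingular_subset_perturbation_class)
    show "perturbation_class sX sY \<subseteq> Phi_cosingular sX sY" if "isomorphic (prod_scale sX) sX"
      using that by (rule perturbation_class_subset_Phi_cosingular)
    show "strictly_cosingular sX sY \<subseteq> Phi_cosingular sX sY"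
      by (rule strictly_cosingular_subset_Phi_cosingular)
  qed (rule Phi_cosingular_subset_strictly_cosingular, blast)
qed

end
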